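(* For every real symmetric positive definite matrix $P$ of order $n$ let $\mathcal{L}_P=\{X\in GL_n : XX^T=P\}$ and $\mathcal{R}_P=\{X\in GL_n : X^TX=P\}$. Then $$GL_n=\bigcup_P\mathcal{L}_P=\bigcup_P\mathcal{R}_P$$ (where the unions are taken over all real symmetric positive definite matrices $P$ of order $n$) are two foliations of $GL_n$, whose leaves are totally geodesic anti-Riemannian submanifolds of $(GL_n,\overline{g})$, all isometric to $(O_n,\overline{g})$.
   Context: $GL_n$ is the group of real invertible matrices of order $n$ and $O_n$ the group of real orthogonal matrices of order $n$. $\overline{g}$ is the trace metric on $GL_n$: the semi-Riemannian metric $\overline{g}_G(V,W)=\operatorname{tr}(G^{-1}VG^{-1}W)$ for $G\in GL_n$ and $V,W$ real matrices of order $n$ (tangent vectors at $G$); the same symbol denotes its restriction to submanifolds. A submanifold is anti-Riemannian if the restriction of $\overline{g}$ to it is negative definite at every point. Here the leaves of the foliations are the sets $\mathcal{L}_P$ (resp. $\mathcal{R}_P$), whether or not they are connected. *)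

theory Defs
  imports "HOL-Analysis.Analysis"
begin

fun Ck_on :: "nat \<Rightarrow> 'a::euclidean_space set \<Rightarrow> ('a \<Rightarrow> 'b::euclidean_space) \<Rightarrow> bool" where
  "Ck_on 0 U f \<longleftrightarrow> continuous_on U f"
| "Ck_on (Suc k) U f \<longleftrightarrow> (\<forall>x\<in>U. f differentiable (at x)) \<and>
     (\<forall>v. Ck_on k U (\<lambda>x. frechet_derivative f (at x) v))"

text \<open>Derivatives are taken in the full space, so \<open>U\<close> is meant to be open.\<close>

definition smooth_on :: "'a::euclidean_space set \<Rightarrow> ('a \<Rightarrow> 'b::euclidean_space) \<Rightarrow> bool" where
  "smooth_on U f \<longleftrightarrow> (\<forall>k. Ck_on k U f)"

text \<open>The ambient manifold is always an open subset \<open>M\<close> of a Euclidean space, and its tangent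
  spaces are identified with that Euclidean space.\<close>

definition smooth_chart :: "'a::euclidean_space set \<Rightarrow> 'a set \<Rightarrow> ('a \<Rightarrow> 'a) \<Rightarrow> bool" where
  "smooth_chart M U \<phi> \<longleftrightarrow> open U \<and> U \<subseteq> M \<and> smooth_on U \<phi> \<and> open (\<phi> ` U) \<and> inj_on \<phi> U \<and>
     smooth_on (\<phi> ` U) (inv_into U \<phi>)"

text \<open>The slice of \<open>V\<close> on which the coordinates outside \<open>B \<subseteq> Basis\<close> are frozen at those of \<open>c\<close>;
  its dimension is \<open>card B\<close>.\<close>

definition coord_slice :: "'a::euclidean_space set \<Rightarrow> 'a set \<Rightarrow> 'a \<Rightarrow> 'a set" where
  "coord_slice V B c = {x \<in> V. \<forall>b \<in> Basis - B. x \<bullet> b = c \<bullet> b}"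

definition submanifold_of_dim :: "nat \<Rightarrow> 'a::euclidean_space set \<Rightarrow> 'a set \<Rightarrow> bool" where
  "submanifold_of_dim k M S \<longleftrightarrow> S \<subseteq> M \<and>
     (\<forall>p\<in>S. \<exists>U \<phi> B c. p \<in> U \<and> smooth_chart M U \<phi> \<and> B \<subseteq> Basis \<and> card B = k \<and>
        \<phi> ` (S \<inter> U) = coord_slice (\<phi> ` U) B c)"

definition submanifold :: "'a::euclidean_space set \<Rightarrow> 'a set \<Rightarrow> bool" where
  "submanifold M S \<longleftrightarrow> (\<exists>k. submanifold_of_dim k M S)"

definition open_cube :: "'a::euclidean_space \<Rightarrow> real \<Rightarrow> 'a set" where
  "open_cube a r = box (a - r *\<^sub>R One) (a + r *\<^sub>R One)"

text \<open>A \<open>k\<close>-dimensional foliation is a partition of \<open>M\<close> into leaves such that \<open>M\<close> is covered by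
  flat charts: the image of the chart is a cube, in which each leaf is a countable (possibly empty)
  union of parallel \<open>k\<close>-dimensional coordinate slices.  Leaves need not be connected, which is
  why they are given as the blocks of a partition.  The slices make each leaf an
  immersed \<open>k\<close>-dimensional submanifold.\<close>

definition foliation_of_dim :: "nat \<Rightarrow> 'a::euclidean_space set \<Rightarrow> 'a set set \<Rightarrow> bool" where
  "foliation_of_dim k M F \<longleftrightarrow> partition_on M F \<and>
     (\<forall>p\<in>M. \<exists>U \<phi> B a r. p \<in> U \<and> smooth_chart M U \<phi> \<and> B \<subseteq> Basis \<and> card B = k \<and>
        r > 0 \<and> \<phi> ` U = open_cube a r \<and>
        (\<forall>L\<in>F. \<exists>C. countable C \<and> \<phi> ` (L \<inter> U) = (\<Union>c\<in>C. coord_slice (\<phi> ` U) B c)))"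

definition foliation :: "'a::euclidean_space set \<Rightarrow> 'a set set \<Rightarrow> bool" where
  "foliation M F \<longleftrightarrow> (\<exists>k. foliation_of_dim k M F)"

definition smooth_curve_in :: "'a::euclidean_space set \<Rightarrow> 'a \<Rightarrow> 'a \<Rightarrow> (real \<Rightarrow> 'a) \<Rightarrow> bool" where
  "smooth_curve_in S p v \<gamma> \<longleftrightarrow> (\<exists>\<epsilon>>0. smooth_on {-\<epsilon><..<\<epsilon>} \<gamma> \<and> \<gamma> ` {-\<epsilon><..<\<epsilon>} \<subseteq> S) \<and>
     \<gamma> 0 = p \<and> (\<gamma> has_vector_derivative v) (at 0)"

definition tangent_space :: "'a::euclidean_space set \<Rightarrow> 'a \<Rightarrow> 'a set" where
  "tangent_space S p = {v. \<exists>\<gamma>. smooth_curve_in S p v \<gamma>}"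

definition smooth_map_on_submanifold ::
    "'a::euclidean_space set \<Rightarrow> ('a \<Rightarrow> 'b::euclidean_space) \<Rightarrow> bool" where
  "smooth_map_on_submanifold S f \<longleftrightarrow>
     (\<forall>p\<in>S. \<exists>U F. open U \<and> p \<in> U \<and> smooth_on U F \<and> (\<forall>x\<in>S \<inter> U. F x = f x))"

definition differential ::
    "'a::euclidean_space set \<Rightarrow> ('a \<Rightarrow> 'b::euclidean_space) \<Rightarrow> 'a \<Rightarrow> 'a \<Rightarrow> 'b" where
  "differential S f p v =
     (THE u. \<exists>\<gamma>. smooth_curve_in S p v \<gamma> \<and> ((f \<circ> \<gamma>) has_vector_derivative u) (at 0))"

text \<open>A metric is a function \<open>g\<close> with \<open>g p v w\<close> the product of \<open>v\<close> and \<open>w\<close>, tangent at \<open>p\<close>.\<close>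

type_synonym 'a metric_tensor = "'a \<Rightarrow> 'a \<Rightarrow> 'a \<Rightarrow> real"

text \<open>On an open subset of a Euclidean space every connection has the form
  \<open>D\<^sub>V W = dW(V) + \<Gamma>(V, W)\<close> with \<open>\<Gamma>\<close> bilinear at every point. It is torsion-free iff \<open>\<Gamma>\<close> is
  symmetric, and compatible with the metric iff the last condition below holds; these
  conditions determine \<open>\<Gamma>\<close>, the Christoffel map of the Levi-Civita connection.\<close>

definition christoffel :: "'a::euclidean_space metric_tensor \<Rightarrow> 'a \<Rightarrow> 'a \<Rightarrow> 'a \<Rightarrow> 'a" where
  "christoffel g p = (THE \<Gamma>. bilinear \<Gamma> \<and> (\<forall>v w. \<Gamma> v w = \<Gamma> w v) \<and>
     (\<forall>z v w. frechet_derivative (\<lambda>x. g x v w) (at p) z = g p (\<Gamma> z v) w + g p v (\<Gamma> z w)))"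

definition levi_civita ::
    "'a::euclidean_space metric_tensor \<Rightarrow> ('a \<Rightarrow> 'a) \<Rightarrow> ('a \<Rightarrow> 'a) \<Rightarrow> 'a \<Rightarrow> 'a" where
  "levi_civita g V W p = frechet_derivative W (at p) (V p) + christoffel g p (V p) (W p)"

text \<open>Nondegenerate restriction of \<open>g\<close>; the index is then automatically locally constant.\<close>

definition semi_riemannian_submanifold ::
    "'a::euclidean_space set \<Rightarrow> 'a metric_tensor \<Rightarrow> 'a set \<Rightarrow> bool" where
  "semi_riemannian_submanifold M g S \<longleftrightarrow> submanifold M S \<and>
     (\<forall>p\<in>S. \<forall>v\<in>tangent_space S p. (\<forall>w\<in>tangent_space S p. g p v w = 0) \<longrightarrow> v = 0)"

definition anti_riemannian_submanifold ::
    "'a::euclidean_space set \<Rightarrow> 'a metric_tensor \<Rightarrow> 'a set \<Rightarrow> bool" where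
  "anti_riemannian_submanifold M g S \<longleftrightarrow> submanifold M S \<and>
     (\<forall>p\<in>S. \<forall>v\<in>tangent_space S p. v \<noteq> 0 \<longrightarrow> g p v v < 0)"

text \<open>Component normal to \<open>S\<close> at \<open>p\<close>; it exists and is unique for semi-Riemannian submanifolds.\<close>

definition normal_part :: "'a::euclidean_space metric_tensor \<Rightarrow> 'a set \<Rightarrow> 'a \<Rightarrow> 'a \<Rightarrow> 'a" where
  "normal_part g S p x =
     (THE n. (\<forall>t\<in>tangent_space S p. g p n t = 0) \<and> x - n \<in> tangent_space S p)"

text \<open>Fields tangent to \<open>S\<close> are represented by local extensions \<open>V\<close>, \<open>W\<close> to the ambient space.\<close>

definition second_fundamental_form ::
    "'a::euclidean_space metric_tensor \<Rightarrow> 'a set \<Rightarrow> ('a \<Rightarrow> 'a) \<Rightarrow> ('a \<Rightarrow> 'a) \<Rightarrow> 'a \<Rightarrow> 'a" where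
  "second_fundamental_form g S V W p = normal_part g S p (levi_civita g V W p)"

definition totally_geodesic ::
    "'a::euclidean_space set \<Rightarrow> 'a metric_tensor \<Rightarrow> 'a set \<Rightarrow> bool" where
  "totally_geodesic M g S \<longleftrightarrow> semi_riemannian_submanifold M g S \<and>
     (\<forall>U V W. open U \<and> U \<subseteq> M \<and> smooth_on U V \<and> smooth_on U W \<and>
        (\<forall>x\<in>S \<inter> U. V x \<in> tangent_space S x \<and> W x \<in> tangent_space S x) \<longrightarrow>
        (\<forall>p\<in>S \<inter> U. second_fundamental_form g S V W p = 0))"

definition isometric_submanifolds ::
    "'a::euclidean_space set \<Rightarrow> 'a metric_tensor \<Rightarrow> 'a set \<Rightarrow> 'a set \<Rightarrow> bool" where
  "isometric_submanifolds M g S T \<longleftrightarrow>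
     semi_riemannian_submanifold M g S \<and> semi_riemannian_submanifold M g T \<and>
     (\<exists>f. bij_betw f S T \<and> smooth_map_on_submanifold S f \<and>
        smooth_map_on_submanifold T (inv_into S f) \<and>
        (\<forall>p\<in>S. \<forall>v\<in>tangent_space S p. \<forall>w\<in>tangent_space S p.
           g (f p) (differential S f p v) (differential S f p w) = g p v w))"

definition GL :: "(real^'n^'n) set" where
  "GL = {A. invertible A}"

definition orthogonal_group :: "(real^'n^'n) set" where
  "orthogonal_group = {A. orthogonal_matrix A}"

definition SPD :: "(real^'n^'n) set" where
  "SPD = {P. transpose P = P \<and> (\<forall>x. x \<noteq> 0 \<longrightarrow> x \<bullet> (P *v x) > 0)}"

definition trace_metric :: "(real^'n^'n) metric_tensor" where
  "trace_metric G V W = trace (matrix_inv G ** V ** matrix_inv G ** W)"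

definition leafL :: "real^'n^'n \<Rightarrow> (real^'n^'n) set" where
  "leafL P = {X \<in> GL. X ** transpose X = P}"

definition leafR :: "real^'n^'n \<Rightarrow> (real^'n^'n) set" where
  "leafR P = {X \<in> GL. transpose X ** X = P}"

end

theory Submission
  imports Defs
begin

text \<open>Both families of leaves are level sets of \<open>X \<mapsto> \<beta> X X\<close> for a bilinear map \<open>\<beta>\<close> with
  \<open>(\<beta> x y)\<^sup>T = \<beta> y x\<close>, namely \<open>\<beta> x y = x y\<^sup>T\<close> or \<open>\<beta> x y = x\<^sup>T y\<close>. Near an invertible \<open>X\<^sub>0\<close> the lower
  triangular entries of \<open>\<beta> X X\<close> together with the strictly upper triangular entries of the
  skew matrix \<open>\<beta> X X\<^sub>0 - \<beta> X\<^sub>0 X\<close> form a chart, by the inverse function theorem; in it the leaves are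
  coordinate slices. Hence the tangent space at \<open>p\<close> is \<open>{v. \<beta> v p + \<beta> p v = 0}\<close>. For
  \<open>\<beta> x y = x y\<^sup>T\<close> these are the \<open>p A\<close> with \<open>A\<close> skew, and the metric is \<open>tr (A A) < 0\<close>.
  The Levi-Civita connection is \<open>dW(v) - (v p\<^sup>-\<^sup>1 w + w p\<^sup>-\<^sup>1 v) / 2\<close>; differentiating the tangency
  condition of \<open>W\<close> along a curve in the leaf shows that its value is again tangent, so the second
  fundamental form vanishes. Multiplication by the inverse of an element of
  the leaf is the isometry with \<open>O\<^sub>n\<close>; that a leaf has elements is the Cholesky factorization.\<close>

section \<open>Smooth maps between open subsets of Euclidean spaces\<close>

text \<open>Derivatives are taken in the full space, so openness of \<open>U\<close> is what lets
  agreement on \<open>U\<close> pass to them.\<close>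

lemma Ck_on_cong:
  assumes "open U" "Ck_on k U f" "\<And>x. x \<in> U \<Longrightarrow> f x = g x"
  shows "Ck_on k U g"
  using assms(2,3)
proof (induction k arbitrary: f g)
  case 0
  then show ?case
    using continuous_on_cong[of U U f g] by simp
next
  case (Suc k)
  have deriv: "(g has_derivative frechet_derivative f (at x)) (at x)" if "x \<in> U" for x
  proof (rule has_derivative_transform_within_open[OF _ assms(1) that])
    show "(f has_derivative frechet_derivative f (at x)) (at x)"
      using Suc.prems(1) that by (simp add: frechet_derivative_works)
  qed (use Suc.prems(2) in simp)
  then have "frechet_derivative f (at x) = frechet_derivative g (at x)" if "x \<in> U" for x
    using that frechet_derivative_at by blast
  note eq = this
  have "Ck_on k U (\<lambda>x. frechet_derivative g (at x) v)" for v
    by (rule Suc.IH[of "\<lambda>x. frechet_derivative f (at x) v"]) (use Suc.prems eq in auto)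
  then show ?case
    using deriv by (auto simp: differentiable_def)
qed

text \<open>Trades the chosen \<open>frechet_derivative\<close> for any explicitly known derivative,
  the form in which most later smoothness arguments run.\<close>

lemma Ck_on_SucI:
  assumes "open U" "\<And>x. x \<in> U \<Longrightarrow> (f has_derivative f' x) (at x)"
    and "\<And>v. Ck_on k U (\<lambda>x. f' x v)"
  shows "Ck_on (Suc k) U f"
proof -
  have "f' x = frechet_derivative f (at x)" if "x \<in> U" for x
    using assms(2) that frechet_derivative_at by blast
  then have "Ck_on k U (\<lambda>x. frechet_derivative f (at x) v)" for v
    using Ck_on_cong[OF assms(1) assms(3)] by simp
  then show ?thesis
    using assms(2) by (auto simp: differentiable_def)
qed

lemma Ck_on_Suc_has_derivative:
  assumes "Ck_on (Suc k) U f" "x \<in> U"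
  shows "(f has_derivative frechet_derivative f (at x)) (at x)"
  using assms by (simp add: frechet_derivative_works)

lemma Ck_on_SucD: "Ck_on (Suc k) U f \<Longrightarrow> Ck_on k U (\<lambda>x. frechet_derivative f (at x) v)"
  by simp

lemma Ck_on_Suc_imp: "Ck_on (Suc k) U f \<Longrightarrow> Ck_on k U f"
proof (induction k arbitrary: f)
  case 0
  then show ?case
    by (auto simp: differentiable_on_def intro!: differentiable_imp_continuous_on
        differentiable_at_imp_differentiable_on)
next
  case (Suc k)
  have "Ck_on k U (\<lambda>x. frechet_derivative f (at x) v)" for v
    by (rule Suc.IH) (use Suc.prems in simp)
  then show ?case
    using Suc.prems by simp
qed

lemma Ck_on_subset: "Ck_on k U f \<Longrightarrow> V \<subseteq> U \<Longrightarrow> Ck_on k V f"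
  by (induction k arbitrary: f) (auto intro: continuous_on_subset)

lemma Ck_on_const: "Ck_on k U (\<lambda>x. c)"
  by (induction k arbitrary: c) auto

lemma Ck_on_compose_linear:
  assumes "bounded_linear h" "open U" "Ck_on k U f"
  shows "Ck_on k U (\<lambda>x. h (f x))"
  using assms(3)
proof (induction k arbitrary: f)
  case 0
  then show ?case
    by (simp add: assms(1) bounded_linear.continuous_on)
next
  case (Suc k)
  show ?case
  proof (rule Ck_on_SucI[OF assms(2)])
    show "((\<lambda>x. h (f x)) has_derivative (\<lambda>v. h (frechet_derivative f (at x) v))) (at x)"
      if "x \<in> U" for x
      using Ck_on_Suc_has_derivative[OF Suc.prems that] bounded_linear.has_derivative[OF assms(1)]
      by blast
  qed (use Suc in simp)
qed

lemma Ck_on_linear: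
  assumes "bounded_linear h" "open U"
  shows "Ck_on k U h"
proof (cases k)
  case 0
  then show ?thesis
    using assms by (simp add: linear_continuous_on)
next
  case (Suc m)
  have "Ck_on (Suc m) U h"
    by (rule Ck_on_SucI[OF assms(2), where f' = "\<lambda>_. h"])
      (use assms(1) in \<open>auto intro: bounded_linear_imp_has_derivative Ck_on_const\<close>)
  then show ?thesis
    using Suc by simp
qed

lemma Ck_on_add:
  assumes "open U" "Ck_on k U f" "Ck_on k U g"
  shows "Ck_on k U (\<lambda>x. f x + g x)"
  using assms(2,3)
proof (induction k arbitrary: f g)
  case 0
  then show ?case
    by (auto intro: continuous_on_add)
next
  case (Suc k)
  show ?case
  proof (rule Ck_on_SucI[OF assms(1)])
    show "((\<lambda>x. f x + g x) has_derivative
        (\<lambda>v. frechet_derivative f (at x) v + frechet_derivative g (at x) v)) (at x)"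
      if "x \<in> U" for x
      using Suc.prems that by (intro has_derivative_add Ck_on_Suc_has_derivative)
  qed (use Suc in simp)
qed

lemma Ck_on_sum:
  assumes "open U" "\<And>i. i \<in> I \<Longrightarrow> Ck_on k U (f i)"
  shows "Ck_on k U (\<lambda>x. \<Sum>i\<in>I. f i x)"
  using assms(2)
proof (induction I rule: infinite_finite_induct)
  case (insert i I)
  have "Ck_on k U (\<lambda>x. f i x + (\<Sum>i\<in>I. f i x))"
    by (rule Ck_on_add[OF assms(1)]) (use insert in auto)
  then show ?case
    using insert.hyps by simp
qed (auto intro: Ck_on_const)

lemma Ck_on_bilinear:
  assumes "bounded_bilinear h" "open U" "Ck_on k U f" "Ck_on k U g"
  shows "Ck_on k U (\<lambda>x. h (f x) (g x))"
  using assms(3,4)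
proof (induction k arbitrary: f g)
  case 0
  then show ?case
    using bounded_bilinear.continuous_on[OF assms(1)] by auto
next
  case (Suc k)
  show ?case
  proof (rule Ck_on_SucI[OF assms(2)])
    show "((\<lambda>x. h (f x) (g x)) has_derivative
        (\<lambda>v. h (f x) (frechet_derivative g (at x) v) + h (frechet_derivative f (at x) v) (g x))) (at x)"
      if "x \<in> U" for x
      using Suc.prems that
      by (intro bounded_bilinear.FDERIV[OF assms(1)] Ck_on_Suc_has_derivative)
    show "Ck_on k U (\<lambda>x. h (f x) (frechet_derivative g (at x) v) + h (frechet_derivative f (at x) v) (g x))"
      for v
      by (rule Ck_on_add[OF assms(2)]; rule Suc.IH;
          rule Ck_on_Suc_imp[OF Suc.prems(1)] Ck_on_Suc_imp[OF Suc.prems(2)]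
            Ck_on_SucD[OF Suc.prems(1)] Ck_on_SucD[OF Suc.prems(2)])
  qed
qed

lemma linear_Basis_expansion:
  fixes h :: "'a::euclidean_space \<Rightarrow> 'b::real_vector"
  assumes "linear h"
  shows "h w = (\<Sum>b\<in>Basis. (w \<bullet> b) *\<^sub>R h b)"
proof -
  have "h w = h (\<Sum>b\<in>Basis. (w \<bullet> b) *\<^sub>R b)"
    by (simp add: euclidean_representation)
  also have "\<dots> = (\<Sum>b\<in>Basis. (w \<bullet> b) *\<^sub>R h b)"
    by (simp add: linear_sum[OF assms] linear_cmul[OF assms])
  finally show ?thesis .
qed

text \<open>\<open>Ck_on\<close> speaks of Euclidean-valued maps, so an operator-valued map is
  controlled through its values on basis vectors. For linear \<open>A x\<close> the sum is
  \<open>A x (w x)\<close>, where operator and argument both vary with \<open>x\<close>.\<close>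

lemma Ck_on_apply_expansion:
  fixes w :: "'c::euclidean_space \<Rightarrow> 'a::euclidean_space"
  assumes "open U" "Ck_on k U w" "\<And>b. b \<in> Basis \<Longrightarrow> Ck_on k U (\<lambda>x. A x b)"
  shows "Ck_on k U (\<lambda>x. \<Sum>b\<in>Basis. (w x \<bullet> b) *\<^sub>R A x b)"
proof (rule Ck_on_sum[OF assms(1)])
  fix b :: 'a
  assume "b \<in> Basis"
  have "Ck_on k U (\<lambda>x. w x \<bullet> b)"
    by (rule Ck_on_compose_linear[OF bounded_linear_inner_left assms(1,2)])
  then show "Ck_on k U (\<lambda>x. (w x \<bullet> b) *\<^sub>R A x b)"
    by (rule Ck_on_bilinear[OF bounded_bilinear_scaleR assms(1) _ assms(3)[OF \<open>b \<in> Basis\<close>]])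
qed

lemma Ck_on_compose:
  assumes "open U" "g ` U \<subseteq> V" "Ck_on k V f" "Ck_on k U g"
  shows "Ck_on k U (\<lambda>x. f (g x))"
  using assms(3,4)
proof (induction k arbitrary: f)
  case 0
  then show ?case
    using assms(2) by (auto intro: continuous_on_compose2)
next
  case (Suc k)
  let ?f' = "\<lambda>x. frechet_derivative f (at (g x))" and ?g' = "\<lambda>x. frechet_derivative g (at x)"
  have df: "(f has_derivative ?f' x) (at (g x))" if "x \<in> U" for x
    using Ck_on_Suc_has_derivative[OF Suc.prems(1)] that assms(2) by blast
  have dg: "(g has_derivative ?g' x) (at x)" if "x \<in> U" for x
    using Ck_on_Suc_has_derivative[OF Suc.prems(2)] that by blast
  show ?case
  proof (rule Ck_on_SucI[OF assms(1)])
    fix x assume x: "x \<in> U"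
    have "((\<lambda>x. f (g x)) has_derivative (\<lambda>v. ?f' x (?g' x v))) (at x)"
      by (rule has_derivative_compose[OF dg[OF x] df[OF x]])
    \<comment> \<open>Both the operator \<open>?f' x\<close> and its argument vary with
      \<open>x\<close>; over the basis the composite becomes a finite sum of products, and the
      induction hypothesis covers the factors \<open>?f' x b\<close>.\<close>
    moreover have "(\<lambda>v. ?f' x (?g' x v)) = (\<lambda>v. \<Sum>b\<in>Basis. (?g' x v \<bullet> b) *\<^sub>R ?f' x b)"
      by (rule ext, rule linear_Basis_expansion[OF has_derivative_linear[OF df[OF x]]])
    ultimately show "((\<lambda>x. f (g x)) has_derivative (\<lambda>v. \<Sum>b\<in>Basis. (?g' x v \<bullet> b) *\<^sub>R ?f' x b)) (at x)"
      by simp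
  next
    have "Ck_on k U (\<lambda>x. ?f' x b)" for b
      by (rule Suc.IH[OF Ck_on_SucD[OF Suc.prems(1)] Ck_on_Suc_imp[OF Suc.prems(2)]])
    then show "Ck_on k U (\<lambda>x. \<Sum>b\<in>Basis. (?g' x v \<bullet> b) *\<^sub>R ?f' x b)" for v
      by (rule Ck_on_apply_expansion[OF assms(1) Ck_on_SucD[OF Suc.prems(2)]])
  qed
qed

section \<open>Inverses of families of linear operators\<close>

text \<open>\<open>A x0\<close> is bounded below by some \<open>c\<close>. Once \<open>A x\<close>
  is within \<open>c / 2\<close> of it, \<open>A x\<close> is bounded below by \<open>c / 2\<close>,
  so the inverses are bounded by \<open>2 / c\<close> near \<open>x0\<close>; continuity then
  follows from the resolvent identity.\<close>

lemma tendsto_inverse_family: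
  fixes A :: "'a::topological_space \<Rightarrow> 'b::euclidean_space \<Rightarrow> 'b"
  assumes "open V" "x0 \<in> V"
    and lin: "\<And>x. x \<in> V \<Longrightarrow> linear (A x)" "\<And>x. x \<in> V \<Longrightarrow> linear (G x)"
    and AG: "\<And>x v. x \<in> V \<Longrightarrow> A x (G x v) = v" and GA: "\<And>x v. x \<in> V \<Longrightarrow> G x (A x v) = v"
    and cont: "\<And>b. ((\<lambda>x. A x b) \<longlongrightarrow> A x0 b) (at x0)"
  shows "((\<lambda>x. G x v) \<longlongrightarrow> G x0 v) (at x0)"
proof -
  have "inj (A x0)"
    using GA[OF \<open>x0 \<in> V\<close>] by (metis injI)
  then obtain c where c: "c > 0" "\<And>u. c * norm u \<le> norm (A x0 u)"
    using linear_inj_bounded_below_pos[OF lin(1)[OF \<open>x0 \<in> V\<close>]] by metis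
  \<comment> \<open>\<open>s x\<close> bounds the operator norm of
    \<open>A x - A x0\<close>.\<close>
  define s where "s x = (\<Sum>b\<in>Basis. norm (A x b - A x0 b))" for x
  have "((\<lambda>x. s x) \<longlongrightarrow> (\<Sum>b\<in>(Basis::'b set). norm (A x0 b - A x0 b))) (at x0)"
    unfolding s_def by (intro tendsto_intros cont)
  then have "eventually (\<lambda>x. s x < c / 2) (at x0)"
    using c(1) by (intro order_tendstoD) auto
  moreover have inV: "eventually (\<lambda>x. x \<in> V) (at x0)"
    using assms(1,2) eventually_at_topological by blast
  ultimately have bound: "eventually (\<lambda>x. \<forall>w. norm (G x w) \<le> norm w * (2 / c)) (at x0)"
  proof eventually_elim
    case (elim x)
    have "norm (G x w) \<le> norm w * (2 / c)" for w
    proof -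
      let ?u = "G x w"
      have "A x ?u - A x0 ?u = (\<Sum>b\<in>Basis. (?u \<bullet> b) *\<^sub>R (A x b - A x0 b))"
        by (rule linear_Basis_expansion[OF linear_compose_sub[OF lin(1)[OF elim(2)] lin(1)[OF assms(2)]]])
      then have "norm (A x ?u - A x0 ?u) \<le> (\<Sum>b\<in>Basis. norm ?u * norm (A x b - A x0 b))"
        by (auto intro!: sum_norm_le mult_right_mono Basis_le_norm)
      also have "\<dots> \<le> norm ?u * (c / 2)"
        using elim(1) by (simp only: s_def flip: sum_distrib_left) (intro mult_left_mono, auto)
      finally have "norm (A x0 ?u) \<le> norm w + norm ?u * (c / 2)"
        using AG[OF elim(2), of w] norm_triangle_sub[of "A x0 ?u" w]
        by (simp add: norm_minus_commute)
      then show ?thesis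
        using c(2)[of ?u] c(1) by (simp add: field_simps)
    qed
    then show ?case by blast
  qed
  have "((\<lambda>x. G x v - G x0 v) \<longlongrightarrow> 0) (at x0)"
  proof (rule Lim_null_comparison)
    show "\<forall>\<^sub>F x in at x0. norm (G x v - G x0 v) \<le> norm (A x0 (G x0 v) - A x (G x0 v)) * (2 / c)"
      using bound inV
    proof eventually_elim
      case (elim x)
      \<comment> \<open>The resolvent identity; the uniform bound is then applied to the outer
        \<open>G x\<close>.\<close>
      have "G x v - G x0 v = G x (A x0 (G x0 v) - A x (G x0 v))"
        using AG GA elim(2) assms(2) by (simp add: linear_diff[OF lin(2)])
      then show ?case
        using elim(1) by simp
    qed
    have "((\<lambda>x. norm (A x0 (G x0 v) - A x (G x0 v)) * (2 / c)) \<longlongrightarrow>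
        norm (A x0 (G x0 v) - A x0 (G x0 v)) * (2 / c)) (at x0)"
      using c(1) by (intro tendsto_intros cont) auto
    then show "((\<lambda>x. norm (A x0 (G x0 v) - A x (G x0 v)) * (2 / c)) \<longlongrightarrow> 0) (at x0)"
      by simp
  qed
  then show ?thesis
    by (simp add: LIM_zero_iff)
qed

text \<open>A product rule in which \<open>h\<close> is merely continuous at \<open>x0\<close>: the
  zero of \<open>s\<close> compensates. It lets an inverse family be differentiated when only its
  continuity is known.\<close>

lemma has_derivative_scaleR_vanishing:
  fixes s :: "'a::real_normed_vector \<Rightarrow> real"
  assumes s: "(s has_derivative s') (at x0)" and "s x0 = 0" and h: "(h \<longlongrightarrow> h x0) (at x0)"
  shows "((\<lambda>x. s x *\<^sub>R h x) has_derivative (\<lambda>v. s' v *\<^sub>R h x0)) (at x0)"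
proof -
  have bl: "bounded_linear s'"
    using s has_derivative_bounded_linear by blast
  have q: "((\<lambda>x. (s x - s x0 - s' (x - x0)) /\<^sub>R norm (x - x0)) \<longlongrightarrow> 0) (at x0)"
    using s unfolding has_derivative_at_within by blast
  obtain K where K: "\<And>v. norm (s' v) \<le> norm v * K"
    using bounded_linear.bounded[OF bl] by blast
  have "((\<lambda>x. (s' (x - x0) / norm (x - x0)) *\<^sub>R (h x - h x0)) \<longlongrightarrow> 0) (at x0)"
  proof (rule Lim_null_comparison)
    show "\<forall>\<^sub>F x in at x0. norm ((s' (x - x0) / norm (x - x0)) *\<^sub>R (h x - h x0)) \<le> \<bar>K\<bar> * norm (h x - h x0)"
    proof (rule always_eventually, intro allI)
      fix x
      have "\<bar>s' (x - x0)\<bar> \<le> norm (x - x0) * \<bar>K\<bar>"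
        using K[of "x - x0"] by (smt (verit) mult_left_mono norm_ge_zero real_norm_def)
      then have le: "\<bar>s' (x - x0)\<bar> / norm (x - x0) \<le> \<bar>K\<bar>"
        by (cases "x = x0") (auto simp: field_simps)
      show "norm ((s' (x - x0) / norm (x - x0)) *\<^sub>R (h x - h x0)) \<le> \<bar>K\<bar> * norm (h x - h x0)"
        using mult_right_mono[OF le norm_ge_zero] by simp
    qed
    have "((\<lambda>x. \<bar>K\<bar> * norm (h x - h x0)) \<longlongrightarrow> \<bar>K\<bar> * norm (h x0 - h x0)) (at x0)"
      by (intro tendsto_intros h)
    then show "((\<lambda>x. \<bar>K\<bar> * norm (h x - h x0)) \<longlongrightarrow> 0) (at x0)"
      by simp
  qed
  \<comment> \<open>The difference quotient of the product splits into the remainder quotient of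
    \<open>s\<close> times \<open>h x\<close> and a bounded factor times
    \<open>h x - h x0\<close>.\<close>
  from tendsto_add[OF tendsto_scaleR[OF q h] this]
  have lim: "((\<lambda>x. ((s x - s x0 - s' (x - x0)) /\<^sub>R norm (x - x0)) *\<^sub>R h x
      + (s' (x - x0) / norm (x - x0)) *\<^sub>R (h x - h x0)) \<longlongrightarrow> 0) (at x0)"
    by simp
  have "((s x - s x0 - s' (x - x0)) /\<^sub>R norm (x - x0)) *\<^sub>R h x
      + (s' (x - x0) / norm (x - x0)) *\<^sub>R (h x - h x0)
      = (s x *\<^sub>R h x - s x0 *\<^sub>R h x0 - s' (x - x0) *\<^sub>R h x0) /\<^sub>R norm (x - x0)" for x
    using assms(2) by (simp add: algebra_simps divide_inverse)
  with lim have "((\<lambda>x. (s x *\<^sub>R h x - s x0 *\<^sub>R h x0 - s' (x - x0) *\<^sub>R h x0) /\<^sub>R norm (x - x0)) \<longlongrightarrow> 0) (at x0)"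
    by simp
  then show ?thesis
    unfolding has_derivative_at_within using bounded_linear_scaleR_const[OF bl] by blast
qed

text \<open>With \<open>u = G x0 v\<close> one has \<open>G x v = u - G x (A x u - A x0 u)\<close>.
  The coordinates of \<open>A x u - A x0 u\<close> vanish at \<open>x0\<close>, so the preceding
  product rule applies with \<open>G\<close> merely continuous.\<close>

lemma has_derivative_inverse_family:
  fixes A :: "'a::real_normed_vector \<Rightarrow> 'b::euclidean_space \<Rightarrow> 'b"
  assumes "open V" "x0 \<in> V"
    and lin: "\<And>x. x \<in> V \<Longrightarrow> linear (A x)" "\<And>x. x \<in> V \<Longrightarrow> linear (G x)"
    and AG: "\<And>x v. x \<in> V \<Longrightarrow> A x (G x v) = v" and GA: "\<And>x v. x \<in> V \<Longrightarrow> G x (A x v) = v"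
    and der: "\<And>b. ((\<lambda>x. A x b) has_derivative A' b) (at x0)"
  shows "((\<lambda>x. G x v) has_derivative (\<lambda>w. - G x0 (A' (G x0 v) w))) (at x0)"
proof -
  let ?u = "G x0 v"
  have contA: "((\<lambda>x. A x b) \<longlongrightarrow> A x0 b) (at x0)" for b
    using has_derivative_continuous[OF der] by (simp add: continuous_at)
  have contG: "((\<lambda>x. G x b) \<longlongrightarrow> G x0 b) (at x0)" for b
    by (rule tendsto_inverse_family[OF assms(1,2) lin AG GA contA])
  have "((\<lambda>x. ((A x ?u - A x0 ?u) \<bullet> b) *\<^sub>R G x b) has_derivative (\<lambda>w. (A' ?u w \<bullet> b) *\<^sub>R G x0 b)) (at x0)"
    for b
    by (rule has_derivative_scaleR_vanishing[OF _ _ contG])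
      (auto intro!: derivative_eq_intros der)
  then have "((\<lambda>x. \<Sum>b\<in>Basis. ((A x ?u - A x0 ?u) \<bullet> b) *\<^sub>R G x b) has_derivative
      (\<lambda>w. \<Sum>b\<in>Basis. (A' ?u w \<bullet> b) *\<^sub>R G x0 b)) (at x0)"
    by (rule has_derivative_sum)
  then have "((\<lambda>x. \<Sum>b\<in>Basis. ((A x ?u - A x0 ?u) \<bullet> b) *\<^sub>R G x b) has_derivative
      (\<lambda>w. G x0 (A' ?u w))) (at x0)"
    by (simp only: linear_Basis_expansion[OF lin(2)[OF assms(2)], symmetric])
  from has_derivative_diff[OF has_derivative_const this]
  have D: "((\<lambda>x. ?u - (\<Sum>b\<in>Basis. ((A x ?u - A x0 ?u) \<bullet> b) *\<^sub>R G x b)) has_derivative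
      (\<lambda>w. - G x0 (A' ?u w))) (at x0)"
    by simp
  show ?thesis
    by (rule has_derivative_transform_within_open[OF D assms(1,2)])
      (use AG GA assms(2) in \<open>simp add: linear_diff[OF lin(2)] flip: linear_Basis_expansion[OF lin(2)]\<close>)
qed

text \<open>The derivative \<open>- G A' G\<close> is assembled from \<open>A'\<close> and
  \<open>G\<close> itself, so by induction \<open>G\<close> inherits each order of smoothness from
  \<open>A\<close>.\<close>

lemma Ck_on_inverse_family:
  fixes A :: "'a::euclidean_space \<Rightarrow> 'b::euclidean_space \<Rightarrow> 'b"
  assumes "open V"
    and lin: "\<And>x. x \<in> V \<Longrightarrow> linear (A x)" "\<And>x. x \<in> V \<Longrightarrow> linear (G x)"
    and AG: "\<And>x v. x \<in> V \<Longrightarrow> A x (G x v) = v" and GA: "\<And>x v. x \<in> V \<Longrightarrow> G x (A x v) = v"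
    and Ck: "\<And>b. Ck_on k V (\<lambda>x. A x b)"
  shows "Ck_on k V (\<lambda>x. G x v)"
  using Ck
proof (induction k arbitrary: v)
  case 0
  then have "((\<lambda>x. A x b) \<longlongrightarrow> A x0 b) (at x0)" if "x0 \<in> V" for x0 b
    using that assms(1) by (simp add: continuous_on_def at_within_open_NO_MATCH)
  note contA = this
  have "((\<lambda>x. G x v) \<longlongrightarrow> G x0 v) (at x0)" if "x0 \<in> V" for x0
    by (rule tendsto_inverse_family[OF assms(1) that lin AG GA contA[OF that]])
  then show ?case
    using assms(1) by (simp add: continuous_on_def at_within_open_NO_MATCH)
next
  case (Suc k)
  let ?A' = "\<lambda>b x. frechet_derivative (\<lambda>x. A x b) (at x)"
  have IH: "Ck_on k V (\<lambda>x. G x v)" for v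
    by (rule Suc.IH[OF Ck_on_Suc_imp[OF Suc.prems]])
  have dA: "((\<lambda>x. A x b) has_derivative ?A' b x) (at x)" if "x \<in> V" for x b
    using Ck_on_Suc_has_derivative[OF Suc.prems that] .
  have dG: "((\<lambda>x. G x v) has_derivative (\<lambda>w. - G x (?A' (G x v) x w))) (at x)" if "x \<in> V" for x
    by (rule has_derivative_inverse_family[OF assms(1) that lin AG GA dA[OF that]])
  \<comment> \<open>The derivative of \<open>A x u\<close> is linear in \<open>u\<close>; expanding
    it in \<open>u\<close> permits inserting the varying vector \<open>G x v\<close> below.\<close>
  have expand: "?A' u x w = (\<Sum>b\<in>Basis. (u \<bullet> b) *\<^sub>R ?A' b x w)" if "x \<in> V" for x u w
  proof -
    have "((\<lambda>y. \<Sum>b\<in>Basis. (u \<bullet> b) *\<^sub>R A y b) has_derivative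
        (\<lambda>w. \<Sum>b\<in>Basis. (u \<bullet> b) *\<^sub>R ?A' b x w)) (at x)"
      by (intro has_derivative_sum has_derivative_scaleR_right dA that)
    then have "((\<lambda>y. A y u) has_derivative (\<lambda>w. \<Sum>b\<in>Basis. (u \<bullet> b) *\<^sub>R ?A' b x w)) (at x)"
      by (rule has_derivative_transform_within_open[OF _ assms(1) that])
        (rule linear_Basis_expansion[OF lin(1), symmetric])
    from has_derivative_unique[OF dA[OF that] this] show ?thesis
      by (rule fun_cong)
  qed
  show ?case
  proof (rule Ck_on_SucI[OF assms(1) dG])
    fix w
    have "Ck_on k V (\<lambda>x. \<Sum>b\<in>Basis. (G x v \<bullet> b) *\<^sub>R ?A' b x w)"
      by (rule Ck_on_apply_expansion[OF assms(1) IH Ck_on_SucD[OF Suc.prems]])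
    then have "Ck_on k V (\<lambda>x. ?A' (G x v) x w)"
      by (rule Ck_on_cong[OF assms(1)]) (use expand in simp)
    then have "Ck_on k V (\<lambda>x. \<Sum>b\<in>Basis. (?A' (G x v) x w \<bullet> b) *\<^sub>R G x b)"
      by (rule Ck_on_apply_expansion[OF assms(1) _ IH])
    then have "Ck_on k V (\<lambda>x. - (\<Sum>b\<in>Basis. (?A' (G x v) x w \<bullet> b) *\<^sub>R G x b))"
      by (rule Ck_on_compose_linear[OF bounded_linear_minus[OF bounded_linear_ident] assms(1)])
    then show "Ck_on k V (\<lambda>x. - G x (?A' (G x v) x w))"
      by (rule Ck_on_cong[OF assms(1)]) (simp add: linear_Basis_expansion[OF lin(2), symmetric])
  qed
qed

text \<open>Bootstrapping: if \<open>g\<close> is of class \<open>k\<close>, so are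
  \<open>f' (g y)\<close> and the inverse operators, which are the derivative of \<open>g\<close>;
  hence \<open>g\<close> gains one order.\<close>

lemma Ck_on_inverse_function:
  fixes g :: "'a::euclidean_space \<Rightarrow> 'a"
  assumes "open V" "g ` V \<subseteq> U" and Ck: "\<And>b. Ck_on k U (\<lambda>x. f' x b)"
    and lin: "\<And>x. x \<in> U \<Longrightarrow> linear (f' x)"
    and bij: "\<And>y. y \<in> V \<Longrightarrow> bij (f' (g y))"
    and g: "\<And>y. y \<in> V \<Longrightarrow> (g has_derivative inv (f' (g y))) (at y)"
  shows "Ck_on (Suc k) V g"
proof -
  have step: "Ck_on (Suc k) V g" if "Ck_on k V g" "\<And>b. Ck_on k U (\<lambda>x. f' x b)" for k
  proof (rule Ck_on_SucI[where f' = "\<lambda>y. inv (f' (g y))"])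
    show "open V" by fact
    show "(g has_derivative inv (f' (g y))) (at y)" if "y \<in> V" for y
      by (rule g[OF that])
    have AG: "f' (g y) (inv (f' (g y)) v) = v" if "y \<in> V" for y v
      by (rule surj_f_inv_f[OF bij_is_surj[OF bij[OF that]]])
    have GA: "inv (f' (g y)) (f' (g y) v) = v" if "y \<in> V" for y v
      by (rule inv_f_f[OF bij_is_inj[OF bij[OF that]]])
    show "Ck_on k V (\<lambda>y. inv (f' (g y)) v)" for v
    proof (rule Ck_on_inverse_family[where A = "\<lambda>y. f' (g y)", OF assms(1)])
      show "Ck_on k V (\<lambda>y. f' (g y) b)" for b
        by (rule Ck_on_compose[OF assms(1,2) that(2) that(1)])
      show "linear (f' (g y))" if "y \<in> V" for y
        using lin assms(2) that by blast
    qed (rule has_derivative_linear[OF g] AG GA, assumption)+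
  qed
  show ?thesis
    using Ck
  proof (induction k)
    case 0
    have "continuous_on V g"
      by (rule continuous_at_imp_continuous_on) (use has_derivative_continuous[OF g] in blast)
    then show ?case
      by (intro step[OF _ 0]) simp
  next
    case (Suc k)
    have "Ck_on (Suc k) V g"
      by (rule Suc.IH[OF Ck_on_Suc_imp[OF Suc.prems]])
    then show ?case
      by (rule step[OF _ Suc.prems])
  qed
qed

section \<open>Charts from the inverse function theorem\<close>

lemma open_contains_open_cube:
  assumes "open V" "a \<in> V"
  obtains r where "r > 0" "open_cube a r \<subseteq> V"
proof -
  obtain e where e: "e > 0" "ball a e \<subseteq> V"
    using assms open_contains_ball by blast
  \<comment> \<open>The Euclidean norm is at most the sum of the \<open>DIM('a)\<close> coordinate
    sizes, each below \<open>r\<close>.\<close>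
  define r where "r = e / real DIM('a)"
  have "dist a x < e" if "x \<in> open_cube a r" for x
  proof -
    have "\<bar>(x - a) \<bullet> b\<bar> < r" if "b \<in> Basis" for b
      using \<open>x \<in> open_cube a r\<close> that
      by (auto simp: open_cube_def mem_box algebra_simps abs_less_iff)
    then have "(\<Sum>b\<in>Basis. \<bar>(x - a) \<bullet> b\<bar>) < (\<Sum>b\<in>(Basis::'a set). r)"
      by (intro sum_strict_mono) auto
    then have "norm (x - a) < e"
      using norm_le_l1[of "x - a"] by (simp add: r_def)
    then show ?thesis
      by (simp add: dist_norm norm_minus_commute)
  qed
  with e show thesis
    by (intro that[of r]) (auto simp: r_def)
qed

text \<open>The inverse function theorem gives a differentiable local inverse and bootstrapping
  makes it smooth. The domain is cut down to the preimage of a cube because flat charts have cubical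
  images.\<close>

lemma inverse_function_smooth_chart:
  fixes f :: "'a::euclidean_space \<Rightarrow> 'a"
  assumes M: "open M" "x0 \<in> M"
    and f: "\<And>x. x \<in> M \<Longrightarrow> (f has_derivative f' x) (at x)"
    and Ck: "\<And>k b. Ck_on k M (\<lambda>x. f' x b)"
    and inj: "inj (f' x0)"
  obtains U r where "x0 \<in> U" "smooth_chart M U f" "r > 0" "f ` U = open_cube (f x0) r"
proof -
  \<comment> \<open>The derivative is repackaged as a bounded operator, whose norm continuity
    follows from continuity on each vector because the dimension is finite.\<close>
  define F where "F x = Blinfun (f' x)" for x
  have F: "blinfun_apply (F x) = f' x" if "x \<in> M" for x
    using has_derivative_bounded_linear[OF f[OF that]] by (simp add: F_def bounded_linear_Blinfun_apply)
  have contF: "continuous_on M F"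
  proof (rule continuous_on_blinfun_componentwise)
    show "continuous_on M (\<lambda>x. blinfun_apply (F x) b)" for b
      using Ck[of 0 b] F by (simp cong: continuous_on_cong)
  qed
  obtain h where h: "linear h" "h \<circ> f' x0 = id"
    using linear_injective_left_inverse[OF has_derivative_linear[OF f[OF M(2)]] inj] by blast
  have "bounded_linear h"
    using h(1) by (simp add: linear_conv_bounded_linear)
  then have "Blinfun h o\<^sub>L F x0 = id_blinfun"
    using h(2) by (intro blinfun_eqI) (simp add: bounded_linear_Blinfun_apply F[OF M(2)] fun_eq_iff)
  moreover have "(f has_derivative blinfun_apply (F x)) (at x)" if "x \<in> M" for x
    using f[OF that] F[OF that] by simp
  ultimately obtain U' V g g' where U': "open U'" "U' \<subseteq> M" "x0 \<in> U'"
    and V: "open V" "f x0 \<in> V" and hom: "homeomorphism U' V f g"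
    and dg: "\<And>y. y \<in> V \<Longrightarrow> (g has_derivative g' y) (at y)"
    and g': "\<And>y. y \<in> V \<Longrightarrow> g' y = inv (blinfun_apply (F (g y)))"
    and bij: "\<And>y. y \<in> V \<Longrightarrow> bij (blinfun_apply (F (g y)))"
    using inverse_function_theorem[OF M(1) _ contF M(2)] by metis
  obtain r where r: "r > 0" "open_cube (f x0) r \<subseteq> V"
    using open_contains_open_cube[OF V] .
  define W where "W = open_cube (f x0) r"
  define U where "U = g ` W"
  have W: "W \<subseteq> V" "open W"
    using r(2) by (auto simp: W_def open_cube_def open_box)
  have gf: "g (f x) = x" if "x \<in> U'" for x
    using hom that by (simp add: homeomorphism_def)
  have fg: "f (g y) = y" if "y \<in> V" for y
    using hom that by (simp add: homeomorphism_def)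
  have fU': "f ` U' = V" and gV: "g ` V = U'" and contf: "continuous_on U' f"
    using hom by (simp_all add: homeomorphism_def)
  have UU': "U \<subseteq> U'"
    using W(1) gV by (auto simp: U_def)
  have "U = U' \<inter> f -` W"
    using UU' W(1) fg gf by (force simp: U_def)
  then have "open U"
    using continuous_on_open_vimage[OF U'(1)] contf W(2) by (metis Int_commute)
  have fU: "f ` U = W"
    using W(1) fg by (force simp: U_def)
  have "f x0 \<in> W"
    using r(1) by (auto simp: W_def open_cube_def mem_box algebra_simps)
  then have "x0 \<in> U"
    using gf[OF U'(3)] by (force simp: U_def)
  have "inj_on f U"
    using gf UU' by (metis inj_on_inverseI subsetD)
  have inv: "inv_into U f y = g y" if "y \<in> W" for y
    using that \<open>inj_on f U\<close> W(1) fg by (metis U_def imageI inv_into_f_f subsetD)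
  have "Ck_on k U f" for k
    using Ck_on_subset[OF Ck_on_Suc_imp[OF Ck_on_SucI[OF M(1) f Ck]]] UU' U'(2) by blast
  moreover have "Ck_on k W g" for k
  proof (rule Ck_on_Suc_imp, rule Ck_on_inverse_function[where f' = f', OF W(2)])
    show "g ` W \<subseteq> M"
      using UU' U'(2) by (auto simp: U_def)
    then have "blinfun_apply (F (g y)) = f' (g y)" if "y \<in> W" for y
      using F that by blast
    then show "bij (f' (g y))" "(g has_derivative inv (f' (g y))) (at y)" if "y \<in> W" for y
      using bij dg g' W(1) that by fastforce+
    show "linear (f' x)" if "x \<in> M" for x
      by (rule has_derivative_linear[OF f[OF that]])
  qed (rule Ck)
  then have "Ck_on k W (inv_into U f)" for k
    using Ck_on_cong[OF W(2)] inv by metis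
  ultimately have "smooth_chart M U f"
    using \<open>open U\<close> \<open>inj_on f U\<close> fU W(2) UU' U'(2)
    by (auto simp: smooth_chart_def smooth_on_def)
  with that[OF \<open>x0 \<in> U\<close> _ r(1)] fU show thesis
    by (simp add: W_def)
qed

lemma smooth_on_linear: "bounded_linear f \<Longrightarrow> open U \<Longrightarrow> smooth_on U f"
  by (simp add: smooth_on_def Ck_on_linear)

section \<open>Matrix products, transposes and traces as bilinear and linear maps\<close>

lemma matrix_add_rdistrib: "(A + B) ** C = A ** C + B ** (C :: 'a::semiring_1^'k^'n)"
  by (simp add: matrix_matrix_mult_def vec_eq_iff distrib_right sum.distrib)

lemma bounded_bilinear_matrix_mult:
  "bounded_bilinear ((**) :: real^'n^'m \<Rightarrow> real^'k^'n \<Rightarrow> real^'k^'m)"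
  by (auto simp: bilinear_conv_bounded_bilinear[symmetric] bilinear_def linear_iff
      matrix_add_ldistrib matrix_add_rdistrib scalar_matrix_assoc matrix_scalar_ac)

lemmas matrix_mult_bilinear_simps =
  bounded_bilinear.add_left[OF bounded_bilinear_matrix_mult]
  bounded_bilinear.add_right[OF bounded_bilinear_matrix_mult]
  bounded_bilinear.diff_left[OF bounded_bilinear_matrix_mult]
  bounded_bilinear.diff_right[OF bounded_bilinear_matrix_mult]
  bounded_bilinear.minus_left[OF bounded_bilinear_matrix_mult]
  bounded_bilinear.minus_right[OF bounded_bilinear_matrix_mult]
  bounded_bilinear.scaleR_left[OF bounded_bilinear_matrix_mult]
  bounded_bilinear.scaleR_right[OF bounded_bilinear_matrix_mult]

lemma bounded_linear_transpose: "bounded_linear (transpose :: real^'n^'m \<Rightarrow> real^'m^'n)"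
  by (auto simp: linear_conv_bounded_linear[symmetric] linear_iff transpose_scalar
      transpose_def vec_eq_iff)

lemma bounded_linear_trace: "bounded_linear (trace :: real^'n^'n \<Rightarrow> real)"
  by (auto simp: linear_conv_bounded_linear[symmetric] linear_iff trace_def sum.distrib sum_distrib_left)

lemmas trace_linear_simps =
  linear_add[OF bounded_linear.linear[OF bounded_linear_trace]]
  linear_diff[OF bounded_linear.linear[OF bounded_linear_trace]]
  linear_neg[OF bounded_linear.linear[OF bounded_linear_trace]]
  linear_cmul[OF bounded_linear.linear[OF bounded_linear_trace]]

lemma
  assumes "invertible (A :: 'a::semiring_1^'n^'n)"
  shows matrix_inv_right: "A ** matrix_inv A = mat 1"
    and matrix_inv_left: "matrix_inv A ** A = mat 1"
proof -
  have "A ** matrix_inv A = mat 1 \<and> matrix_inv A ** A = mat 1"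
    using assms unfolding invertible_def matrix_inv_def by (rule someI_ex)
  then show "A ** matrix_inv A = mat 1" "matrix_inv A ** A = mat 1"
    by auto
qed

lemma matrix_inv_cancel:
  assumes "invertible (A :: 'a::semiring_1^'n^'n)"
  shows "A ** (matrix_inv A ** B) = B" "matrix_inv A ** (A ** B) = B"
    "B ** A ** matrix_inv A = B" "B ** matrix_inv A ** A = B"
  using matrix_inv_right[OF assms] matrix_inv_left[OF assms]
  by (simp_all add: matrix_mul_assoc flip: matrix_mul_assoc[of B])

lemma open_GL: "open (GL :: (real^'n^'n) set)"
proof -
  have "open {A :: real^'n^'n. det A \<noteq> 0}"
    unfolding det_def by (intro open_Collect_neq continuous_intros)
  then show ?thesis
    by (simp add: GL_def invertible_det_nz)
qed

text \<open>Testing with \<open>transpose A\<close> gives the sum of the squared entries.\<close>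

lemma trace_mult_eq_0:
  assumes "\<And>X :: real^'n^'n. trace (A ** X) = 0"
  shows "A = 0"
proof -
  have "(\<Sum>i\<in>UNIV. \<Sum>j\<in>UNIV. A $ i $ j * A $ i $ j) = 0"
    using assms[of "transpose A"] by (simp add: trace_def matrix_matrix_mult_def transpose_def)
  then have "(\<Sum>j\<in>UNIV. A $ i $ j * A $ i $ j) = 0" for i
    by (subst (asm) sum_nonneg_eq_0_iff) (auto intro: sum_nonneg)
  then have "A $ i $ j * A $ i $ j = 0" for i j
    by (subst (asm) sum_nonneg_eq_0_iff) auto
  then show ?thesis
    by (simp add: vec_eq_iff)
qed

lemma trace_mult_transpose_pos:
  assumes "A \<noteq> (0 :: real^'n^'n)"
  shows "trace (A ** transpose A) > 0"
proof -
  have eq: "trace (A ** transpose A) = (\<Sum>i\<in>UNIV. \<Sum>j\<in>UNIV. A $ i $ j * A $ i $ j)"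
    by (simp add: trace_def matrix_matrix_mult_def transpose_def)
  obtain i j where "A $ i $ j \<noteq> 0"
    using assms by (auto simp: vec_eq_iff)
  then have "0 < A $ i $ j * A $ i $ j"
    by (metis linorder_neqE_linordered_idom mult_neg_neg mult_pos_pos)
  then have "0 < (\<Sum>j\<in>UNIV. A $ i $ j * A $ i $ j)"
    by (intro sum_pos2[of UNIV j "\<lambda>j. A $ i $ j * A $ i $ j"]) auto
  then show ?thesis
    unfolding eq by (intro sum_pos2[of UNIV i "\<lambda>i. \<Sum>j\<in>UNIV. A $ i $ j * A $ i $ j"]) (auto intro: sum_nonneg)
qed

section \<open>The trace metric and its Levi-Civita connection\<close>

text \<open>Left multiplications by \<open>x\<close> and by its inverse are mutually inverse
  operators depending on \<open>x\<close> in the open set \<open>GL\<close>, an instance of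
  \<open>has_derivative_inverse_family\<close>.\<close>

lemma has_derivative_matrix_inv_mult:
  fixes p v :: "real^'n^'n"
  assumes "invertible p"
  shows "((\<lambda>x. matrix_inv x ** v) has_derivative
    (\<lambda>z. - (matrix_inv p ** (z ** (matrix_inv p ** v))))) (at p)"
proof (rule has_derivative_inverse_family[where A = "(**)" and V = GL and G = "\<lambda>x. (**) (matrix_inv x)"
      and A' = "\<lambda>b z. z ** b"])
  show "open (GL :: (real^'n^'n) set)"
    by (rule open_GL)
  show "p \<in> GL"
    using assms by (simp add: GL_def)
  show "linear ((**) x)" "linear ((**) (matrix_inv x))" for x :: "real^'n^'n"
    by (intro bounded_linear.linear bounded_bilinear.bounded_linear_right[OF bounded_bilinear_matrix_mult])+
  show "((\<lambda>x. x ** b) has_derivative (\<lambda>z. z ** b)) (at p)" for b :: "real^'n^'n"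
    by (intro bounded_linear_imp_has_derivative bounded_bilinear.bounded_linear_left[OF bounded_bilinear_matrix_mult])
qed (auto simp: GL_def matrix_inv_cancel)

lemma frechet_derivative_trace_metric:
  assumes "invertible (p :: real^'n^'n)"
  shows "frechet_derivative (\<lambda>x. trace_metric x v w) (at p) z =
    - trace (matrix_inv p ** z ** matrix_inv p ** v ** matrix_inv p ** w)
    - trace (matrix_inv p ** v ** matrix_inv p ** z ** matrix_inv p ** w)"
proof -
  have "((\<lambda>x. trace ((matrix_inv x ** v) ** (matrix_inv x ** w))) has_derivative
     (\<lambda>z. trace ((matrix_inv p ** v) ** (- (matrix_inv p ** (z ** (matrix_inv p ** w)))) +
        (- (matrix_inv p ** (z ** (matrix_inv p ** v)))) ** (matrix_inv p ** w)))) (at p)"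
    by (intro bounded_linear.has_derivative[OF bounded_linear_trace]
        bounded_bilinear.FDERIV[OF bounded_bilinear_matrix_mult]
        has_derivative_matrix_inv_mult[OF assms])
  then have "((\<lambda>x. trace_metric x v w) has_derivative
     (\<lambda>z. trace ((matrix_inv p ** v) ** (- (matrix_inv p ** (z ** (matrix_inv p ** w)))) +
        (- (matrix_inv p ** (z ** (matrix_inv p ** v)))) ** (matrix_inv p ** w)))) (at p)"
    by (simp add: trace_metric_def matrix_mul_assoc)
  from frechet_derivative_at[OF this, symmetric] show ?thesis
    by (simp add: trace_linear_simps matrix_mult_bilinear_simps matrix_mul_assoc)
qed

lemma trace_metric_nondegenerate:
  assumes "invertible p" "\<And>w. trace_metric p v w = 0"
  shows "v = 0"
proof -
  have "trace (matrix_inv p ** v ** matrix_inv p ** X) = 0" for X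
    using assms(2) by (simp add: trace_metric_def)
  then have "matrix_inv p ** v ** matrix_inv p = 0"
    by (rule trace_mult_eq_0)
  then have "p ** (matrix_inv p ** v ** matrix_inv p) ** p = 0"
    by simp
  then show ?thesis
    using assms(1) by (simp add: matrix_mul_assoc matrix_inv_cancel matrix_inv_right)
qed

lemma trace_metric_bilinear: "bilinear (trace_metric p)"
  by (simp add: bilinear_def trace_metric_def linear_iff trace_linear_simps matrix_mult_bilinear_simps)

lemma trace_metric_sym: "trace_metric p v w = trace_metric p w v"
  unfolding trace_metric_def
  by (metis matrix_mul_assoc trace_mul_sym)

text \<open>The candidate is compatible with the metric by the derivative formula and cyclicity of
  the trace. Uniqueness, which the \<open>THE\<close> in \<open>christoffel\<close> requires, is the
  Koszul argument for the difference \<open>D\<close> of two solutions.\<close>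

lemma christoffel_trace_metric:
  assumes p: "invertible (p :: real^'n^'n)"
  shows "christoffel trace_metric p =
    (\<lambda>v w. (- 1 / 2) *\<^sub>R (v ** matrix_inv p ** w + w ** matrix_inv p ** v))" (is "_ = ?\<Gamma>")
  unfolding christoffel_def
proof (rule the_equality)
  have "bilinear ?\<Gamma>"
    by (simp add: bilinear_def linear_iff matrix_mult_bilinear_simps algebra_simps)
  moreover have "frechet_derivative (\<lambda>x. trace_metric x v w) (at p) z =
      trace_metric p (?\<Gamma> z v) w + trace_metric p v (?\<Gamma> z w)" for z v w
  proof -
    let ?T = "\<lambda>a b c. trace (matrix_inv p ** a ** matrix_inv p ** b ** matrix_inv p ** c)"
    have cyc: "?T v w z = ?T z v w"
      by (metis matrix_mul_assoc trace_mul_sym)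
    have "trace_metric p (?\<Gamma> z v) w = (- 1 / 2) * (?T z v w + ?T v z w)"
      by (simp add: trace_metric_def trace_linear_simps matrix_mult_bilinear_simps matrix_mul_assoc)
    moreover have "trace_metric p v (?\<Gamma> z w) = (- 1 / 2) * (?T v z w + ?T v w z)"
      by (simp add: trace_metric_def trace_linear_simps matrix_mult_bilinear_simps matrix_mul_assoc)
    ultimately show ?thesis
      by (simp add: frechet_derivative_trace_metric[OF p] cyc field_simps)
  qed
  ultimately show "bilinear ?\<Gamma> \<and> (\<forall>v w. ?\<Gamma> v w = ?\<Gamma> w v) \<and>
      (\<forall>z v w. frechet_derivative (\<lambda>x. trace_metric x v w) (at p) z =
        trace_metric p (?\<Gamma> z v) w + trace_metric p v (?\<Gamma> z w))"
    by (simp add: add.commute)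
  note \<Gamma> = this
  fix \<Gamma>
  assume \<Gamma>': "bilinear \<Gamma> \<and> (\<forall>v w. \<Gamma> v w = \<Gamma> w v) \<and>
      (\<forall>z v w. frechet_derivative (\<lambda>x. trace_metric x v w) (at p) z =
        trace_metric p (\<Gamma> z v) w + trace_metric p v (\<Gamma> z w))"
  define D where "D v w = \<Gamma> v w - ?\<Gamma> v w" for v w
  have sym: "D v w = D w v" for v w
    using \<Gamma> \<Gamma>' unfolding D_def by metis
  have skew: "trace_metric p (D z v) w = - trace_metric p (D z w) v" for z v w
  proof -
    have "trace_metric p (\<Gamma> z v) w + trace_metric p v (\<Gamma> z w) =
        trace_metric p (?\<Gamma> z v) w + trace_metric p v (?\<Gamma> z w)"
      using \<Gamma> \<Gamma>' by metis
    then show ?thesis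
      unfolding D_def bilinear_lsub[OF trace_metric_bilinear]
      by (simp only: trace_metric_sym[of p v])
  qed
  \<comment> \<open>The trilinear expression is symmetric in its first two arguments and skew in its
    last two; alternating these exchanges returns to the start with the opposite sign.\<close>
  have "trace_metric p (D v w) z = 0" for v w z
    using sym skew by (smt (verit, ccfv_SIG))
  then have "D v w = 0" for v w
    using trace_metric_nondegenerate[OF p] by blast
  then show "\<Gamma> = ?\<Gamma>"
    unfolding D_def by (intro ext) (metis eq_iff_diff_eq_0)
qed

section \<open>Curves, normal parts and linear isometries\<close>

text \<open>The curve is the preimage under the chart of the segment through \<open>\<phi> p\<close>
  in direction \<open>D v\<close>, so it stays in the slice of its initial point whenever
  \<open>D v\<close> is parallel to that slice.\<close>

lemma smooth_chart_curve:
  assumes chart: "smooth_chart M U \<phi>" and p: "p \<in> U" and D: "(\<phi> has_derivative D) (at p)"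
  obtains \<gamma> \<epsilon> where "\<epsilon> > 0" "smooth_on {-\<epsilon><..<\<epsilon>} \<gamma>" "\<gamma> ` {-\<epsilon><..<\<epsilon>} \<subseteq> U" "\<gamma> 0 = p"
    "\<forall>t\<in>{-\<epsilon><..<\<epsilon>}. \<phi> (\<gamma> t) = \<phi> p + t *\<^sub>R D v" "(\<gamma> has_vector_derivative v) (at 0)"
proof -
  define \<psi> where "\<psi> = inv_into U \<phi>"
  define l where "l t = \<phi> p + t *\<^sub>R D v" for t
  have open_U: "open U" and open_V: "open (\<phi> ` U)" and inj: "inj_on \<phi> U"
    and smooth: "Ck_on k (\<phi> ` U) \<psi>" for k
    using chart by (auto simp: smooth_chart_def smooth_on_def \<psi>_def)
  have \<psi>\<phi>: "\<psi> (\<phi> x) = x" if "x \<in> U" for x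
    using inj that by (simp add: \<psi>_def)
  obtain \<psi>' where \<psi>': "(\<psi> has_derivative \<psi>') (at (\<phi> p))"
    using Ck_on_Suc_has_derivative[OF smooth] p by blast
  have "((\<lambda>x. \<psi> (\<phi> x)) has_derivative (\<lambda>x. \<psi>' (D x))) (at p)"
    by (rule has_derivative_compose[OF D \<psi>'])
  then have "((\<lambda>x. x) has_derivative (\<lambda>x. \<psi>' (D x))) (at p)"
    by (rule has_derivative_transform_within_open[OF _ open_U p]) (rule \<psi>\<phi>)
  \<comment> \<open>The derivative of the inverse chart is a left inverse of \<open>D\<close>, hence
    the lifted curve has velocity exactly \<open>v\<close>.\<close>
  from has_derivative_unique[OF this has_derivative_ident] have \<psi>'D: "\<psi>' (D v) = v"
    by (rule fun_cong)
  have Ck_l: "Ck_on k T l" if "open T" for k T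
    unfolding l_def
    by (intro Ck_on_add[OF that] Ck_on_const Ck_on_linear[OF bounded_linear_scaleR_left that])
  then have "continuous_on UNIV l"
    by (metis Ck_on.simps(1) open_UNIV)
  then have "open (l -` (\<phi> ` U))"
    using open_V by (simp add: open_vimage)
  moreover have "0 \<in> l -` (\<phi> ` U)"
    using p by (simp add: l_def)
  ultimately obtain \<epsilon> where \<epsilon>: "\<epsilon> > 0" "ball 0 \<epsilon> \<subseteq> l -` (\<phi> ` U)"
    using open_contains_ball by blast
  then have l: "l ` {-\<epsilon><..<\<epsilon>} \<subseteq> \<phi> ` U"
    by (auto simp: ball_eq_greaterThanLessThan)
  have "(l has_vector_derivative D v) (at 0)"
    unfolding l_def by (auto intro!: derivative_eq_intros)
  moreover have "(\<psi> has_derivative \<psi>') (at (l 0) within range l)"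
    using \<psi>' by (simp add: l_def has_derivative_at_withinI)
  ultimately have "((\<psi> \<circ> l) has_vector_derivative \<psi>' (D v)) (at 0)"
    by (rule vector_derivative_diff_chain_within)
  then have vd: "((\<psi> \<circ> l) has_vector_derivative v) (at 0)"
    by (simp only: \<psi>'D)
  have "Ck_on k {-\<epsilon><..<\<epsilon>} (\<lambda>t. \<psi> (l t))" for k
    by (rule Ck_on_compose[OF _ l smooth Ck_l]) auto
  then have sm: "smooth_on {-\<epsilon><..<\<epsilon>} (\<psi> \<circ> l)"
    by (simp add: smooth_on_def o_def)
  have im: "(\<psi> \<circ> l) ` {-\<epsilon><..<\<epsilon>} \<subseteq> U"
    using l \<psi>\<phi> by fastforce
  have "\<phi> ((\<psi> \<circ> l) t) = l t" if "t \<in> {-\<epsilon><..<\<epsilon>}" for t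
    unfolding \<psi>_def o_apply by (rule f_inv_into_f) (use l that in blast)
  with that[OF \<epsilon>(1) sm im] vd \<psi>\<phi>[OF p] show thesis
    by (simp add: l_def)
qed

lemma normal_part_eq_0:
  assumes "subspace (tangent_space S p)" "x \<in> tangent_space S p"
    and "\<And>v. v \<in> tangent_space S p \<Longrightarrow> (\<And>w. w \<in> tangent_space S p \<Longrightarrow> g p v w = 0) \<Longrightarrow> v = 0"
    and "\<And>w. g p 0 w = 0"
  shows "normal_part g S p x = 0"
  unfolding normal_part_def
proof (rule the_equality)
  fix n
  assume n: "(\<forall>t\<in>tangent_space S p. g p n t = 0) \<and> x - n \<in> tangent_space S p"
  \<comment> \<open>\<open>n\<close> is a difference of two tangent vectors, so it is tangent as
    well as normal, and nondegeneracy makes it zero.\<close>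
  then have "x - (x - n) \<in> tangent_space S p"
    using assms(1,2) subspace_diff by blast
  then show "n = 0"
    using n assms(3) by simp
qed (use assms in auto)

text \<open>Every curve with velocity \<open>v\<close> is sent to one with velocity
  \<open>f v\<close>, so the \<open>THE\<close> in \<open>differential\<close> has one candidate;
  tangency of \<open>v\<close> supplies a curve.\<close>

lemma differential_linear:
  assumes "bounded_linear f" "v \<in> tangent_space S p"
  shows "differential S f p v = f v"
proof -
  have D: "((f \<circ> \<gamma>) has_vector_derivative f v) (at 0)" if "smooth_curve_in S p v \<gamma>" for \<gamma>
    using that bounded_linear.has_vector_derivative[OF assms(1)]
    by (simp add: smooth_curve_in_def o_def)
  show ?thesis
    unfolding differential_def
  proof (rule the_equality)
    show "\<exists>\<gamma>. smooth_curve_in S p v \<gamma> \<and> ((f \<circ> \<gamma>) has_vector_derivative f v) (at 0)"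
      using assms(2) D by (auto simp: tangent_space_def)
  next
    fix u
    assume "\<exists>\<gamma>. smooth_curve_in S p v \<gamma> \<and> ((f \<circ> \<gamma>) has_vector_derivative u) (at 0)"
    then show "u = f v"
      using D vector_derivative_unique_at by blast
  qed
qed

text \<open>For restrictions of ambient linear maps, smooth extensions exist globally and the
  differential is the map itself. What remains is algebra: the inclusions, the inverse and the
  metric identity.\<close>

lemma isometric_submanifolds_linearI:
  assumes "semi_riemannian_submanifold M g S" "semi_riemannian_submanifold M g T"
    and lin: "bounded_linear f" "bounded_linear h"
    and ST: "f ` S \<subseteq> T" "h ` T \<subseteq> S"
    and inv: "\<And>x. x \<in> S \<Longrightarrow> h (f x) = x" "\<And>y. y \<in> T \<Longrightarrow> f (h y) = y"
    and g: "\<And>p v w. p \<in> S \<Longrightarrow> g (f p) (f v) (f w) = g p v w"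
  shows "isometric_submanifolds M g S T"
proof -
  have bij: "bij_betw f S T"
    using ST inv by (intro bij_betw_byWitness[where f' = h]) auto
  have h: "inv_into S f y = h y" if "y \<in> T" for y
    using bij ST(2) inv(2) that by (intro inv_into_f_eq) (auto simp: bij_betw_def)
  have "smooth_map_on_submanifold S f"
    unfolding smooth_map_on_submanifold_def using smooth_on_linear[OF lin(1) open_UNIV] by blast
  moreover have "smooth_map_on_submanifold T (inv_into S f)"
    unfolding smooth_map_on_submanifold_def using smooth_on_linear[OF lin(2) open_UNIV] h
    by (metis IntD1 UNIV_I open_UNIV)
  ultimately show ?thesis
    unfolding isometric_submanifolds_def
    using assms(1,2) bij g by (auto simp: differential_linear[OF lin(1)] intro!: exI[of _ f])
qed

section \<open>Lower triangular parts of matrices\<close>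

text \<open>\<open>to_nat\<close> is an arbitrary enumeration of the index type; it only serves to order it.\<close>

definition lower_part :: "real^'n^'n \<Rightarrow> real^'n^'n" where
  "lower_part A = (\<chi> i j. if to_nat j \<le> to_nat i then A $ i $ j else 0)"

text \<open>The coordinate directions along the leaves in the flat charts; there are n(n - 1)/2 of
  them, the dimension of the orthogonal group.\<close>

definition upper_basis :: "(real^'n^'n) set" where
  "upper_basis = {axis i (axis j 1) |i j. to_nat i < to_nat j}"

lemma upper_basis_subset: "upper_basis \<subseteq> Basis"
  by (auto simp: upper_basis_def)

text \<open>The bridge from triangular parts to \<open>coord_slice\<close>, in which the coordinates
  outside \<open>upper_basis\<close> are frozen.\<close>

lemma lower_part_eq_iff:
  "lower_part A = lower_part B \<longleftrightarrow> (\<forall>b\<in>Basis - upper_basis. A \<bullet> b = B \<bullet> b)"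
proof
  assume eq: "lower_part A = lower_part B"
  show "\<forall>b\<in>Basis - upper_basis. A \<bullet> b = B \<bullet> b"
  proof
    fix b :: "real^'a^'a"
    assume b: "b \<in> Basis - upper_basis"
    then obtain i j where ij: "b = axis i (axis j 1)"
      by (auto simp: Basis_vec_def)
    then have "to_nat j \<le> to_nat i"
      using b by (auto simp: upper_basis_def not_less[symmetric])
    then have "A $ i $ j = B $ i $ j"
      using arg_cong[OF eq, of "\<lambda>M. M $ i $ j"] by (simp add: lower_part_def)
    then show "A \<bullet> b = B \<bullet> b"
      by (simp add: ij inner_axis)
  qed
next
  assume eq: "\<forall>b\<in>Basis - upper_basis. A \<bullet> b = B \<bullet> b"
  have "A $ i $ j = B $ i $ j" if "to_nat j \<le> to_nat i" for i j
  proof -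
    have "axis i (axis j 1) \<in> Basis - (upper_basis :: (real^'a^'a) set)"
      using that by (auto simp: upper_basis_def axis_eq_axis)
    with eq have "A \<bullet> axis i (axis j 1) = B \<bullet> axis i (axis j 1)"
      by blast
    then show ?thesis
      by (simp add: inner_axis)
  qed
  then show "lower_part A = lower_part B"
    by (simp add: lower_part_def vec_eq_iff)
qed

lemma bounded_linear_lower_part: "bounded_linear lower_part"
  by (auto simp: linear_conv_bounded_linear[symmetric] linear_iff lower_part_def vec_eq_iff)

lemmas lower_part_linear_simps =
  linear_add[OF bounded_linear.linear[OF bounded_linear_lower_part]]
  linear_diff[OF bounded_linear.linear[OF bounded_linear_lower_part]]
  linear_cmul[OF bounded_linear.linear[OF bounded_linear_lower_part]]
  linear_0[OF bounded_linear.linear[OF bounded_linear_lower_part]]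

lemma lower_part_idem: "lower_part (lower_part A) = lower_part A"
  by (simp add: lower_part_def vec_eq_iff)

text \<open>Reflection in the diagonal recovers the remaining entries. This is why the lower entries
  of \<open>\<beta> X X\<close> alone single out a leaf.\<close>

lemma symmetric_eq_if_lower_part_eq:
  assumes "transpose A = A" "transpose B = B" "lower_part A = lower_part B"
  shows "A = B"
proof -
  have low: "A $ i $ j = B $ i $ j" if "to_nat j \<le> to_nat i" for i j
    using arg_cong[OF assms(3), of "\<lambda>M. M $ i $ j"] that by (simp add: lower_part_def)
  moreover have "A $ i $ j = A $ j $ i" "B $ i $ j = B $ j $ i" for i j
    using arg_cong[OF assms(1), of "\<lambda>M. M $ i $ j"] arg_cong[OF assms(2), of "\<lambda>M. M $ i $ j"]
    by (simp_all add: transpose_def)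
  ultimately have "A $ i $ j = B $ i $ j" for i j
    by (metis linorder_linear)
  then show ?thesis
    by (simp add: vec_eq_iff)
qed

section \<open>Leaves of a bilinear form\<close>

text \<open>The assumption \<open>form_christoffel\<close> says that for tangent \<open>v\<close>, \<open>w\<close> the derivative of
  \<open>\<beta> w p + \<beta> p w\<close> and the Christoffel term cancel.\<close>

locale leaf_form =
  fixes \<beta> :: "real^'n^'n \<Rightarrow> real^'n^'n \<Rightarrow> real^'n^'n"
  assumes bilinear_form: "bounded_bilinear \<beta>"
    and transpose_form: "transpose (\<beta> x y) = \<beta> y x"
    and form_cancel: "invertible x \<Longrightarrow> \<beta> v x = 0 \<Longrightarrow> v = 0"
    and form_SPD: "invertible x \<Longrightarrow> \<beta> x x \<in> SPD"
    and SPD_form: "P \<in> SPD \<Longrightarrow> \<exists>x. invertible x \<and> \<beta> x x = P"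
    and form_christoffel: "invertible p \<Longrightarrow> \<beta> v p + \<beta> p v = 0 \<Longrightarrow> \<beta> w p + \<beta> p w = 0 \<Longrightarrow>
      \<beta> (v ** matrix_inv p ** w) p + \<beta> p (v ** matrix_inv p ** w) = - (\<beta> v w + \<beta> w v)"
    and form_negative: "invertible p \<Longrightarrow> \<beta> v p + \<beta> p v = 0 \<Longrightarrow> v \<noteq> 0 \<Longrightarrow> trace_metric p v v < 0"
begin

abbreviation leaf :: "real^'n^'n \<Rightarrow> (real^'n^'n) set" where
  "leaf P \<equiv> {X \<in> GL. \<beta> X X = P}"

sublocale form: bounded_bilinear \<beta>
  by (rule bilinear_form)

lemma form_self_sym: "transpose (\<beta> x x) = \<beta> x x"
  by (rule transpose_form)

lemma SPD_sym: "P \<in> SPD \<Longrightarrow> transpose P = P"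
  by (simp add: SPD_def)

text \<open>The symmetric matrix \<open>\<beta> X X\<close> supplies the transverse coordinates and
  a skew matrix, linear in \<open>X\<close>, those along the leaves. They occupy complementary
  entries, so everything reduces to injectivity of the derivative at \<open>X0\<close>.\<close>

lemma foliation_chart:
  assumes X0: "X0 \<in> GL"
  obtains U \<phi> r where "X0 \<in> U" "smooth_chart GL U \<phi>" "r > 0" "\<phi> ` U = open_cube (\<phi> X0) r"
    "\<forall>X\<in>U. lower_part (\<phi> X) = lower_part (\<beta> X X)"
proof -
  define up where "up A = A - lower_part A" for A :: "real^'n^'n"
  define \<phi> where "\<phi> X = lower_part (\<beta> X X) + up (\<beta> X X0 - \<beta> X0 X)" for X
  define \<phi>' where "\<phi>' X V = lower_part (\<beta> X V + \<beta> V X) + up (\<beta> V X0 - \<beta> X0 V)" for X V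
  have bl_up: "bounded_linear up"
    unfolding up_def by (intro bounded_linear_sub bounded_linear_ident bounded_linear_lower_part)
  have lower_up: "lower_part (lower_part A + up B) = lower_part A" for A B
    by (simp only: up_def lower_part_linear_simps lower_part_idem) simp
  have bl0: "bounded_linear (\<lambda>X. up (\<beta> X X0 - \<beta> X0 X))"
    by (intro bounded_linear_compose[OF bl_up] bounded_linear_sub
        form.bounded_linear_left form.bounded_linear_right)
  have low: "lower_part (\<phi> X) = lower_part (\<beta> X X)" for X
    unfolding \<phi>_def by (rule lower_up)
  have der: "(\<phi> has_derivative \<phi>' X) (at X)" for X
    unfolding \<phi>_def \<phi>'_def
    by (intro has_derivative_add bounded_linear_imp_has_derivative[OF bl0]
        bounded_linear.has_derivative[OF bounded_linear_lower_part]
        form.FDERIV has_derivative_ident)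
  have Ck: "Ck_on k GL (\<lambda>X. \<phi>' X V)" for k V
    unfolding \<phi>'_def
    by (intro Ck_on_add Ck_on_const open_GL Ck_on_compose_linear[OF bounded_linear_lower_part]
        Ck_on_linear form.bounded_linear_left form.bounded_linear_right)
  have "inj (\<phi>' X0)"
  proof -
    have "V = 0" if V: "\<phi>' X0 V = 0" for V
    proof -
      \<comment> \<open>Vanishing of the derivative makes \<open>W\<close> skew through the lower
        entries and symmetric off the diagonal through the upper ones; so \<open>W = 0\<close>, and
        \<open>form_cancel\<close> gives \<open>V = 0\<close>.\<close>
      define W where "W = \<beta> V X0"
      have WT: "\<beta> X0 V = transpose W"
        by (simp add: W_def transpose_form)
      have eq: "lower_part (transpose W + W) + up (W - transpose W) = 0"
        using V by (simp add: \<phi>'_def WT flip: W_def)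
      have "lower_part (lower_part (transpose W + W) + up (W - transpose W)) = lower_part 0"
        by (simp only: eq)
      then have lower: "lower_part (transpose W + W) = lower_part 0"
        by (simp only: lower_up)
      have "transpose W + W = 0"
        by (rule symmetric_eq_if_lower_part_eq[OF _ _ lower])
          (simp_all add: transpose_def vec_eq_iff)
      then have skew: "W $ j $ i = - W $ i $ j" for i j
        by (simp add: transpose_def vec_eq_iff eq_neg_iff_add_eq_0)
      have up0: "up (W - transpose W) = 0"
        using eq lower by (simp add: lower_part_linear_simps)
      then have upper: "W $ i $ j = W $ j $ i" if "\<not> to_nat j \<le> to_nat i" for i j
      proof -
        have "up (W - transpose W) $ i $ j = 0"
          by (simp only: up0 zero_index)
        then show ?thesis
          using that by (simp add: up_def lower_part_def transpose_def)
      qed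
      have "W $ i $ j = 0" for i j
      proof (cases "i = j")
        case True
        then show ?thesis
          using skew[of i i] by simp
      next
        case False
        then have "W $ i $ j = W $ j $ i"
          using upper by (metis to_nat_split antisym)
        then show ?thesis
          using skew[of i j] by simp
      qed
      then have "W = 0"
        by (simp add: vec_eq_iff)
      then show "V = 0"
        using form_cancel X0 by (simp add: W_def GL_def)
    qed
    then show ?thesis
      using linear_injective_0[OF has_derivative_linear[OF der]] by blast
  qed
  from inverse_function_smooth_chart[OF open_GL X0 der Ck this]
  obtain U r where "X0 \<in> U" "smooth_chart GL U \<phi>" "r > 0" "\<phi> ` U = open_cube (\<phi> X0) r" .
  then show thesis
    by (rule that) (simp add: low)
qed

lemma leaf_slice:
  assumes "P \<in> SPD" and low: "\<forall>X\<in>U. lower_part (\<phi> X) = lower_part (\<beta> X X)"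
    and "U \<subseteq> GL"
  shows "\<phi> ` (leaf P \<inter> U) = coord_slice (\<phi> ` U) upper_basis P"
proof -
  have "\<beta> X X = P \<longleftrightarrow> (\<forall>b\<in>Basis - upper_basis. \<phi> X \<bullet> b = P \<bullet> b)" if "X \<in> U" for X
    using symmetric_eq_if_lower_part_eq[OF form_self_sym SPD_sym[OF assms(1)], of X] bspec[OF low that]
    by (auto simp flip: lower_part_eq_iff)
  then show ?thesis
    using assms(3) by (auto simp: coord_slice_def)
qed

lemma GL_eq_Union_leaf: "GL = (\<Union>P\<in>SPD. leaf P)"
  using form_SPD by (auto simp: GL_def)

lemma foliation_leaves: "foliation GL (leaf ` SPD)"
proof -
  have "partition_on GL (leaf ` SPD)"
  proof (rule partition_onI)
    show "\<Union> (leaf ` SPD) = GL"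
      using GL_eq_Union_leaf by simp
    \<comment> \<open>Blocks of a partition are nonempty, which is where the existence of a
      factorization of each \<open>P\<close> enters.\<close>
    show "{} \<notin> leaf ` SPD"
    proof
      assume "{} \<in> leaf ` SPD"
      then obtain P where P: "P \<in> SPD" "leaf P = {}"
        by auto
      obtain x where "invertible x" "\<beta> x x = P"
        using SPD_form[OF P(1)] by blast
      then have "x \<in> leaf P"
        by (simp add: GL_def)
      then show False
        using P(2) by blast
    qed
  qed (auto simp: disjnt_def)
  moreover have "\<exists>U \<phi> B a r. X \<in> U \<and> smooth_chart GL U \<phi> \<and> B \<subseteq> Basis \<and>
      card B = card (upper_basis :: (real^'n^'n) set) \<and> r > 0 \<and> \<phi> ` U = open_cube a r \<and>
      (\<forall>L\<in>leaf ` SPD. \<exists>C. countable C \<and> \<phi> ` (L \<inter> U) = (\<Union>c\<in>C. coord_slice (\<phi> ` U) B c))"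
    if "X \<in> GL" for X
  proof -
    obtain U \<phi> r where U: "X \<in> U" "smooth_chart GL U \<phi>" "r > 0" "\<phi> ` U = open_cube (\<phi> X) r"
      and low: "\<forall>X\<in>U. lower_part (\<phi> X) = lower_part (\<beta> X X)"
      using foliation_chart[OF \<open>X \<in> GL\<close>] .
    have "U \<subseteq> GL"
      using U(2) by (simp add: smooth_chart_def)
    \<comment> \<open>Within a chart a leaf is a single slice, so a singleton index set serves; if
      the leaf misses the chart domain, that slice is empty.\<close>
    have "\<exists>C. countable C \<and> \<phi> ` (leaf P \<inter> U) = (\<Union>c\<in>C. coord_slice (\<phi> ` U) upper_basis c)"
      if "P \<in> SPD" for P
      by (rule exI[of _ "{P}"]) (simp add: leaf_slice[OF that low \<open>U \<subseteq> GL\<close>])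
    then show ?thesis
      using U upper_basis_subset
      by (intro exI[of _ U] exI[of _ \<phi>] exI[of _ upper_basis] exI[of _ "\<phi> X"] exI[of _ r]) auto
  qed
  ultimately have "foliation_of_dim (card (upper_basis :: (real^'n^'n) set)) GL (leaf ` SPD)"
    unfolding foliation_of_dim_def by (intro conjI ballI)
  then show ?thesis
    unfolding foliation_def by (rule exI)
qed

lemma submanifold_leaf:
  assumes "P \<in> SPD"
  shows "submanifold GL (leaf P)"
proof -
  have "\<exists>U \<phi> B c. X \<in> U \<and> smooth_chart GL U \<phi> \<and> B \<subseteq> Basis \<and>
      card B = card (upper_basis :: (real^'n^'n) set) \<and>
      \<phi> ` (leaf P \<inter> U) = coord_slice (\<phi> ` U) B c"
    if "X \<in> leaf P" for X
  proof -
    have "X \<in> GL"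
      using that by blast
    obtain U \<phi> r where U: "X \<in> U" "smooth_chart GL U \<phi>" "r > 0" "\<phi> ` U = open_cube (\<phi> X) r"
      and low: "\<forall>X\<in>U. lower_part (\<phi> X) = lower_part (\<beta> X X)"
      using foliation_chart[OF \<open>X \<in> GL\<close>] .
    moreover have "U \<subseteq> GL"
      using U(2) by (simp add: smooth_chart_def)
    ultimately show ?thesis
      using leaf_slice[OF assms low] upper_basis_subset
      by (intro exI[of _ U] exI[of _ \<phi>] exI[of _ upper_basis] exI[of _ P]) auto
  qed
  then have "submanifold_of_dim (card (upper_basis :: (real^'n^'n) set)) GL (leaf P)"
    unfolding submanifold_of_dim_def by (intro conjI ballI) auto
  then show ?thesis
    unfolding submanifold_def by (rule exI)
qed

text \<open>One inclusion differentiates \<open>\<beta> (\<gamma> t) (\<gamma> t) = P\<close>. For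
  the other, the condition on \<open>v\<close> says that its image in the flat chart is parallel to
  the slices, so the lifted segment stays in the leaf.\<close>

lemma tangent_space_leaf:
  assumes P: "P \<in> SPD" and p: "p \<in> leaf P"
  shows "tangent_space (leaf P) p = {v. \<beta> v p + \<beta> p v = 0}"
proof (intro subset_antisym subsetI)
  fix v
  assume "v \<in> tangent_space (leaf P) p"
  then obtain \<gamma> \<epsilon> where \<gamma>: "\<epsilon> > 0" "\<gamma> ` {-\<epsilon><..<\<epsilon>} \<subseteq> leaf P" "\<gamma> 0 = p"
      "(\<gamma> has_vector_derivative v) (at 0)"
    by (auto simp: tangent_space_def smooth_curve_in_def)
  have "((\<lambda>t. \<beta> (\<gamma> t) (\<gamma> t)) has_vector_derivative \<beta> (\<gamma> 0) v + \<beta> v (\<gamma> 0)) (at 0)"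
    by (rule form.has_vector_derivative[OF \<gamma>(4) \<gamma>(4)])
  then have "((\<lambda>t. P) has_vector_derivative \<beta> (\<gamma> 0) v + \<beta> v (\<gamma> 0)) (at 0)"
  proof (rule has_vector_derivative_transform_within_open[where S = "{-\<epsilon><..<\<epsilon>}"])
    show "\<beta> (\<gamma> t) (\<gamma> t) = P" if "t \<in> {-\<epsilon><..<\<epsilon>}" for t
      using \<gamma>(2) that by blast
  qed (use \<gamma>(1) in auto)
  then have "\<beta> (\<gamma> 0) v + \<beta> v (\<gamma> 0) = 0"
    by (rule vector_derivative_unique_at[OF _ has_vector_derivative_const])
  then show "v \<in> {v. \<beta> v p + \<beta> p v = 0}"
    by (simp add: \<gamma>(3) add.commute)
next
  fix v
  assume v: "v \<in> {v. \<beta> v p + \<beta> p v = 0}"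
  have "p \<in> GL"
    using p by blast
  obtain U \<phi> r where U: "p \<in> U" "smooth_chart GL U \<phi>" "r > 0" "\<phi> ` U = open_cube (\<phi> p) r"
      and low: "\<forall>X\<in>U. lower_part (\<phi> X) = lower_part (\<beta> X X)"
    using foliation_chart[OF \<open>p \<in> GL\<close>] .
  have "open U" "U \<subseteq> GL" and smooth: "Ck_on (Suc 0) U \<phi>"
    using U(2) by (auto simp only: smooth_chart_def smooth_on_def)
  obtain D where D: "(\<phi> has_derivative D) (at p)"
    using Ck_on_Suc_has_derivative[OF smooth U(1)] by blast
  \<comment> \<open>The derivative of one map is computed twice, through the chart and through
    \<open>\<beta>\<close>; uniqueness then identifies the lower part of \<open>D v\<close>.\<close>
  have "((\<lambda>X. lower_part (\<phi> X)) has_derivative (\<lambda>w. lower_part (D w))) (at p)"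
    by (rule bounded_linear.has_derivative[OF bounded_linear_lower_part D])
  then have D1: "((\<lambda>X. lower_part (\<beta> X X)) has_derivative (\<lambda>w. lower_part (D w))) (at p)"
    by (rule has_derivative_transform_within_open[OF _ \<open>open U\<close> U(1)]) (use low in blast)
  have D2: "((\<lambda>X. lower_part (\<beta> X X)) has_derivative (\<lambda>w. lower_part (\<beta> p w + \<beta> w p))) (at p)"
    by (intro bounded_linear.has_derivative[OF bounded_linear_lower_part]
        form.FDERIV has_derivative_ident)
  have "lower_part (D v) = lower_part (\<beta> p v + \<beta> v p)"
    using fun_cong[OF has_derivative_unique[OF D1 D2], of v] .
  moreover have "\<beta> p v + \<beta> v p = 0"
    using v by (simp add: add.commute)
  ultimately have Dv: "lower_part (D v) = 0"
    by (simp only: lower_part_linear_simps(4))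
  obtain \<gamma> \<epsilon> where \<gamma>: "\<epsilon> > 0" "smooth_on {-\<epsilon><..<\<epsilon>} \<gamma>" "\<gamma> ` {-\<epsilon><..<\<epsilon>} \<subseteq> U" "\<gamma> 0 = p"
    "\<forall>t\<in>{-\<epsilon><..<\<epsilon>}. \<phi> (\<gamma> t) = \<phi> p + t *\<^sub>R D v" "(\<gamma> has_vector_derivative v) (at 0)"
    using smooth_chart_curve[OF U(2) U(1) D] .
  have "\<gamma> t \<in> leaf P" if t: "t \<in> {-\<epsilon><..<\<epsilon>}" for t
  proof -
    have "\<gamma> t \<in> U"
      using \<gamma>(3) t by blast
    then have "lower_part (\<beta> (\<gamma> t) (\<gamma> t)) = lower_part (\<phi> p + t *\<^sub>R D v)"
      using bspec[OF low \<open>\<gamma> t \<in> U\<close>] bspec[OF \<gamma>(5) t] by simp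
    also have "\<dots> = lower_part P"
      using bspec[OF low U(1)] p Dv by (simp add: lower_part_linear_simps)
    finally have "\<beta> (\<gamma> t) (\<gamma> t) = P"
      by (rule symmetric_eq_if_lower_part_eq[OF form_self_sym SPD_sym[OF P]])
    then show ?thesis
      using \<open>\<gamma> t \<in> U\<close> \<open>U \<subseteq> GL\<close> by auto
  qed
  then have "smooth_curve_in (leaf P) p v \<gamma>"
    unfolding smooth_curve_in_def using \<gamma> by blast
  then show "v \<in> tangent_space (leaf P) p"
    by (auto simp: tangent_space_def)
qed

lemma trace_metric_leaf_negative:
  assumes "P \<in> SPD" "p \<in> leaf P" "v \<in> tangent_space (leaf P) p" "v \<noteq> 0"
  shows "trace_metric p v v < 0"
proof (rule form_negative[OF _ _ assms(4)])
  show "invertible p"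
    using assms(2) by (simp add: GL_def)
  show "\<beta> v p + \<beta> p v = 0"
    using assms(3) unfolding tangent_space_leaf[OF assms(1,2)] by simp
qed

lemma anti_riemannian_leaf:
  assumes "P \<in> SPD"
  shows "anti_riemannian_submanifold GL trace_metric (leaf P)"
  unfolding anti_riemannian_submanifold_def
proof (intro conjI ballI impI)
  show "submanifold GL (leaf P)"
    by (rule submanifold_leaf[OF assms])
  show "trace_metric p v v < 0" if "p \<in> leaf P" "v \<in> tangent_space (leaf P) p" "v \<noteq> 0" for p v
    by (rule trace_metric_leaf_negative[OF assms that])
qed

lemma semi_riemannian_leaf:
  assumes "P \<in> SPD"
  shows "semi_riemannian_submanifold GL trace_metric (leaf P)"
  unfolding semi_riemannian_submanifold_def
proof (intro conjI ballI impI submanifold_leaf assms)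
  fix p v
  assume p: "p \<in> leaf P" and v: "v \<in> tangent_space (leaf P) p"
    and 0: "\<forall>w\<in>tangent_space (leaf P) p. trace_metric p v w = 0"
  have "trace_metric p v v = 0"
    using 0 v by (rule bspec)
  then show "v = 0"
    using trace_metric_leaf_negative[OF assms p v] by (cases "v = 0") simp_all
qed

text \<open>Tangency of \<open>W\<close> is an equation known on the leaf only, so it is
  differentiated along a curve in the leaf with velocity \<open>V p\<close>.\<close>

lemma levi_civita_tangent:
  assumes P: "P \<in> SPD" and U: "open U" "p \<in> leaf P \<inter> U"
    and W: "smooth_on U W"
    and V_tan: "V p \<in> tangent_space (leaf P) p"
    and W_tan: "\<And>x. x \<in> leaf P \<inter> U \<Longrightarrow> W x \<in> tangent_space (leaf P) x"
  shows "levi_civita trace_metric V W p \<in> tangent_space (leaf P) p"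
proof -
  define v w w' where "v = V p" and "w = W p" and "w' = frechet_derivative W (at p) v"
  have p: "invertible p" "p \<in> leaf P" "p \<in> U"
    using U by (auto simp: GL_def)
  have "Ck_on (Suc 0) U W"
    using W unfolding smooth_on_def by blast
  then have dW: "(W has_derivative frechet_derivative W (at p)) (at p)"
    using p(3) by (rule Ck_on_Suc_has_derivative)
  obtain \<gamma> \<epsilon> where \<gamma>: "\<epsilon> > 0" "smooth_on {-\<epsilon><..<\<epsilon>} \<gamma>" "\<gamma> ` {-\<epsilon><..<\<epsilon>} \<subseteq> leaf P" "\<gamma> 0 = p"
      "(\<gamma> has_vector_derivative v) (at 0)"
    using V_tan by (auto simp: tangent_space_def smooth_curve_in_def v_def)
  have W\<gamma>: "((\<lambda>t. W (\<gamma> t)) has_vector_derivative w') (at 0)"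
  proof -
    have "(W has_derivative frechet_derivative W (at p)) (at (\<gamma> 0) within range \<gamma>)"
      unfolding \<gamma>(4) by (rule has_derivative_at_withinI[OF dW])
    from vector_derivative_diff_chain_within[OF \<gamma>(5) this] show ?thesis
      by (simp only: o_def w'_def)
  qed
  have "((\<lambda>t. \<beta> (W (\<gamma> t)) (\<gamma> t) + \<beta> (\<gamma> t) (W (\<gamma> t))) has_vector_derivative
      (\<beta> (W (\<gamma> 0)) v + \<beta> w' (\<gamma> 0)) + (\<beta> (\<gamma> 0) w' + \<beta> v (W (\<gamma> 0)))) (at 0)"
    by (intro has_vector_derivative_add form.has_vector_derivative W\<gamma> \<gamma>(5))
  moreover have "continuous_on {-\<epsilon><..<\<epsilon>} \<gamma>"
    using \<gamma>(2) unfolding smooth_on_def by (metis Ck_on.simps(1))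
  \<comment> \<open>\<open>W\<close> is tangent to the leaf only inside \<open>U\<close>, so the
    interval is cut down to the open set of times spent in \<open>U\<close>.\<close>
  then have "open ({-\<epsilon><..<\<epsilon>} \<inter> \<gamma> -` U)"
    using continuous_open_preimage U(1) open_greaterThanLessThan by blast
  moreover have "0 \<in> {-\<epsilon><..<\<epsilon>} \<inter> \<gamma> -` U"
    using \<gamma>(1,4) p(3) by auto
  moreover have "\<beta> (W (\<gamma> t)) (\<gamma> t) + \<beta> (\<gamma> t) (W (\<gamma> t)) = 0" if "t \<in> {-\<epsilon><..<\<epsilon>} \<inter> \<gamma> -` U" for t
  proof -
    have t: "\<gamma> t \<in> leaf P \<inter> U"
      using that \<gamma>(3) by blast
    then show ?thesis
      using W_tan[OF t] tangent_space_leaf[OF P] by blast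
  qed
  ultimately have const: "((\<lambda>t. 0) has_vector_derivative
      (\<beta> (W (\<gamma> 0)) v + \<beta> w' (\<gamma> 0)) + (\<beta> (\<gamma> 0) w' + \<beta> v (W (\<gamma> 0)))) (at 0)"
    by (rule has_vector_derivative_transform_within_open)
  have eq: "(\<beta> w v + \<beta> w' p) + (\<beta> p w' + \<beta> v w) = 0"
    using vector_derivative_unique_at[OF const has_vector_derivative_const] by (simp only: \<gamma>(4) w_def)
  have v: "\<beta> v p + \<beta> p v = 0" and w: "\<beta> w p + \<beta> p w = 0"
    using V_tan W_tan[OF U(2)] tangent_space_leaf[OF P p(2)] by (auto simp: v_def w_def)
  \<comment> \<open>Each of \<open>a\<close> and \<open>b\<close> contributes
    \<open>- (\<beta> v w + \<beta> w v)\<close>, so subtracting half their sum cancels the same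
    contribution of \<open>w'\<close>.\<close>
  define a b where "a = v ** matrix_inv p ** w" and "b = w ** matrix_inv p ** v"
  have "levi_civita trace_metric V W p = w' - (1 / 2) *\<^sub>R (a + b)"
    by (simp add: levi_civita_def christoffel_trace_metric[OF p(1)] v_def w_def w'_def a_def b_def)
  moreover have "\<beta> (w' - (1 / 2) *\<^sub>R (a + b)) p + \<beta> p (w' - (1 / 2) *\<^sub>R (a + b)) =
      (\<beta> w' p + \<beta> p w') - (1 / 2) *\<^sub>R ((\<beta> a p + \<beta> p a) + (\<beta> b p + \<beta> p b))"
    by (simp add: form.diff_left form.diff_right form.scaleR_left form.scaleR_right
        form.add_left form.add_right algebra_simps)
  moreover have "\<beta> a p + \<beta> p a = - (\<beta> v w + \<beta> w v)" "\<beta> b p + \<beta> p b = - (\<beta> v w + \<beta> w v)"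
    using form_christoffel[OF p(1) v w] form_christoffel[OF p(1) w v]
    by (simp_all add: a_def b_def add.commute)
  moreover have "\<beta> w' p + \<beta> p w' = - (\<beta> v w + \<beta> w v)"
    using eq by (simp add: algebra_simps eq_neg_iff_add_eq_0)
  ultimately have "\<beta> (levi_civita trace_metric V W p) p + \<beta> p (levi_civita trace_metric V W p) = 0"
    by (simp add: scaleR_2[symmetric])
  then show ?thesis
    using tangent_space_leaf[OF P p(2)] by blast
qed

lemma totally_geodesic_leaf:
  assumes P: "P \<in> SPD"
  shows "totally_geodesic GL trace_metric (leaf P)"
  unfolding totally_geodesic_def second_fundamental_form_def
proof (intro conjI allI impI ballI)
  show semi: "semi_riemannian_submanifold GL trace_metric (leaf P)"
    by (rule semi_riemannian_leaf[OF P])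
  fix U p and V W :: "real^'n^'n \<Rightarrow> real^'n^'n"
  assume UVW: "open U \<and> U \<subseteq> GL \<and> smooth_on U V \<and> smooth_on U W \<and>
      (\<forall>x\<in>leaf P \<inter> U. V x \<in> tangent_space (leaf P) x \<and> W x \<in> tangent_space (leaf P) x)"
    and p: "p \<in> leaf P \<inter> U"
  show "normal_part trace_metric (leaf P) p (levi_civita trace_metric V W p) = 0"
  proof (rule normal_part_eq_0)
    have "p \<in> leaf P"
      using p by blast
    show "subspace (tangent_space (leaf P) p)"
      unfolding tangent_space_leaf[OF P \<open>p \<in> leaf P\<close>]
    proof (intro subspaceI CollectI)
      fix x y and c :: real
      assume "x \<in> {v. \<beta> v p + \<beta> p v = 0}" "y \<in> {v. \<beta> v p + \<beta> p v = 0}"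
      then have x: "\<beta> x p + \<beta> p x = 0" and y: "\<beta> y p + \<beta> p y = 0"
        by simp_all
      have "\<beta> (x + y) p + \<beta> p (x + y) = (\<beta> x p + \<beta> p x) + (\<beta> y p + \<beta> p y)"
        by (simp add: form.add_left form.add_right)
      then show "\<beta> (x + y) p + \<beta> p (x + y) = 0"
        by (simp only: x y add_0_left)
      have "\<beta> (c *\<^sub>R x) p + \<beta> p (c *\<^sub>R x) = c *\<^sub>R (\<beta> x p + \<beta> p x)"
        by (simp add: form.scaleR_left form.scaleR_right scaleR_add_right)
      then show "\<beta> (c *\<^sub>R x) p + \<beta> p (c *\<^sub>R x) = 0"
        by (simp only: x scaleR_zero_right)
    qed (simp add: form.zero_left form.zero_right)
    show "levi_civita trace_metric V W p \<in> tangent_space (leaf P) p"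
      by (rule levi_civita_tangent[OF P, of U]) (use UVW p in auto)
    show "v = 0" if "v \<in> tangent_space (leaf P) p"
      "\<And>w. w \<in> tangent_space (leaf P) p \<Longrightarrow> trace_metric p v w = 0" for v
      using trace_metric_leaf_negative[OF P \<open>p \<in> leaf P\<close> that(1)] that(2)[OF that(1)]
      by (cases "v = 0") simp_all
    show "trace_metric p 0 w = 0" for w
      by (rule bilinear_lzero[OF trace_metric_bilinear])
  qed
qed

end

section \<open>Factorization of symmetric positive definite matrices\<close>

text \<open>The support condition on \<open>X\<close> leaves column \<open>i\<close> free in the inductive step, where the pivot
  column of \<open>P\<close>, scaled by \<open>1 / sqrt (P $ i $ i)\<close>, is put.\<close>

lemma symmetric_factorization:
  fixes P :: "real^'n^'n"
  assumes "finite I" "transpose P = P" "\<And>i j. i \<notin> I \<Longrightarrow> P $ i $ j = 0"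
    and "\<And>x. x \<noteq> 0 \<Longrightarrow> (\<And>i. i \<notin> I \<Longrightarrow> x $ i = 0) \<Longrightarrow> x \<bullet> (P *v x) > 0"
  shows "\<exists>X :: real^'n^'n. X ** transpose X = P \<and> (\<forall>i j. j \<notin> I \<longrightarrow> X $ i $ j = 0)"
  using assms
proof (induction I arbitrary: P rule: finite_induct)
  case empty
  then have "P = 0"
    by (simp add: vec_eq_iff)
  then show ?case
    by (intro exI[of _ 0]) (simp add: vec_eq_iff matrix_matrix_mult_def)
next
  case (insert i I)
  define c where "c = P *v axis i 1"
  define d where "d = P $ i $ i"
  have sym: "P $ k $ l = P $ l $ k" for k l
    using arg_cong[OF insert.prems(1), of "\<lambda>M. M $ k $ l"] by (simp add: transpose_def)
  have c: "c $ k = P $ k $ i" for k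
    by (simp add: c_def matrix_vector_mult_basis column_def)
  have self_adjoint: "x \<bullet> (P *v y) = y \<bullet> (P *v x)" for x y
    by (metis dot_lmul_matrix inner_commute insert.prems(1) transpose_matrix_vector)
  have "axis i 1 \<bullet> (P *v axis i 1) > 0"
    by (rule insert.prems(3)) (auto simp: axis_def vec_eq_iff)
  then have d: "d > 0"
    by (simp add: d_def inner_axis' c flip: c_def)
  \<comment> \<open>The Schur complement of the pivot \<open>d\<close>: subtracting this rank one
    matrix clears row and column \<open>i\<close>, so the support shrinks to
    \<open>I\<close>.\<close>
  define P' where "P' = P - (\<chi> k l. c $ k * c $ l / d)"
  have P'x: "P' *v x = P *v x - ((c \<bullet> x) / d) *\<^sub>R c" for x
    by (simp add: P'_def vec_eq_iff matrix_vector_mult_def inner_vec_def sum_distrib_left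
        sum_divide_distrib sum_subtractf left_diff_distrib right_diff_distrib mult_ac sum_distrib_right)
  have "\<exists>X :: real^'n^'n. X ** transpose X = P' \<and> (\<forall>i j. j \<notin> I \<longrightarrow> X $ i $ j = 0)"
  proof (rule insert.IH)
    show "transpose P' = P'"
      using sym by (simp add: P'_def transpose_def vec_eq_iff mult.commute)
    show "P' $ k $ l = 0" if "k \<notin> I" for k l
    proof (cases "k = i")
      case True
      then show ?thesis
        using d sym[of i l] by (simp add: P'_def c d_def)
    next
      case False
      then show ?thesis
        using that insert.prems(2) by (simp add: P'_def c)
    qed
    fix x :: "real^'n"
    assume x: "x \<noteq> 0" "\<And>k. k \<notin> I \<Longrightarrow> x $ k = 0"
    \<comment> \<open>\<open>y\<close> minimizes the quadratic form of \<open>P\<close> on the line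
      through \<open>x\<close> in direction \<open>axis i 1\<close>, and the minimum is the value of
      the form of \<open>P'\<close> at \<open>x\<close>. As \<open>x\<close> vanishes at
      \<open>i\<close>, the shift leaves a nonzero coordinate intact.\<close>
    define y where "y = x - ((c \<bullet> x) / d) *\<^sub>R axis i 1"
    obtain k where k: "x $ k \<noteq> 0"
      using x(1) by (auto simp: vec_eq_iff)
    then have "k \<noteq> i"
      using x(2) insert.hyps by auto
    then have "y $ k \<noteq> 0"
      using k by (simp add: y_def axis_def)
    then have "y \<noteq> 0"
      by auto
    then have "y \<bullet> (P *v y) > 0"
      by (rule insert.prems(3)) (use x(2) in \<open>auto simp: y_def axis_def\<close>)
    also have "y \<bullet> (P *v y) = x \<bullet> (P *v x) - (c \<bullet> x)\<^sup>2 / d"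
    proof -
      have Py: "P *v y = P *v x - ((c \<bullet> x) / d) *\<^sub>R c"
        by (simp add: y_def c_def matrix_vector_mult_diff_distrib matrix_vector_mult_scaleR)
      have "axis i 1 \<bullet> (P *v x) = c \<bullet> x"
        using self_adjoint[of "axis i 1" x] by (simp add: c_def inner_commute)
      moreover have "axis i 1 \<bullet> c = d"
        by (simp add: inner_axis' c d_def)
      ultimately show ?thesis
        using d unfolding Py by (simp add: y_def inner_diff_left inner_diff_right inner_commute[of x c]
            power2_eq_square field_simps)
    qed
    also have "\<dots> = x \<bullet> (P' *v x)"
      by (simp add: P'x inner_diff_right inner_commute[of x c] power2_eq_square)
    finally show "x \<bullet> (P' *v x) > 0" .
  qed
  then obtain X' :: "real^'n^'n" where X': "X' ** transpose X' = P'"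
    and supp: "\<And>k l. l \<notin> I \<Longrightarrow> X' $ k $ l = 0"
    by blast
  \<comment> \<open>Column \<open>i\<close> of \<open>X'\<close> is zero because \<open>i\<close> is
    not in \<open>I\<close>; filling it adds exactly the rank one matrix removed from
    \<open>P\<close>.\<close>
  define X where "X = (\<chi> k l. if l = i then c $ k / sqrt d else X' $ k $ l)"
  have "(X ** transpose X) $ k $ l = P $ k $ l" for k l
  proof -
    have "(X ** transpose X) $ k $ l = (\<Sum>m\<in>UNIV. X $ k $ m * X $ l $ m)"
      by (simp add: matrix_matrix_mult_def transpose_def)
    also have "\<dots> = X $ k $ i * X $ l $ i + (\<Sum>m\<in>UNIV - {i}. X $ k $ m * X $ l $ m)"
      by (rule sum.remove) auto
    also have "(\<Sum>m\<in>UNIV - {i}. X $ k $ m * X $ l $ m) = (\<Sum>m\<in>UNIV - {i}. X' $ k $ m * X' $ l $ m)"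
      by (intro sum.cong) (auto simp: X_def)
    also have "\<dots> = (\<Sum>m\<in>UNIV. X' $ k $ m * X' $ l $ m)"
      using supp[OF insert.hyps(2)] by (subst (2) sum.remove[of _ i]) auto
    also have "\<dots> = P' $ k $ l"
      unfolding X'[symmetric] by (simp add: matrix_matrix_mult_def transpose_def)
    also have "X $ k $ i * X $ l $ i = c $ k * c $ l / d"
      using d by (simp add: X_def)
    finally show ?thesis
      by (simp add: P'_def)
  qed
  moreover have "X $ k $ l = 0" if "l \<notin> insert i I" for k l
    using that supp by (simp add: X_def)
  ultimately show ?case
    by (intro exI[of _ X]) (simp add: vec_eq_iff)
qed

lemma SPD_invertible:
  assumes "P \<in> SPD"
  shows "invertible P"
proof -
  have "x = 0" if "P *v x = 0" for x
    using assms that unfolding SPD_def by (metis (mono_tags, lifting) inner_zero_right less_irrefl mem_Collect_eq)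
  then show ?thesis
    by (metis invertible_left_inverse matrix_left_invertible_ker)
qed

lemma SPD_factorization:
  fixes P :: "real^'n^'n"
  assumes "P \<in> SPD"
  obtains X :: "real^'n^'n" where "invertible X" "X ** transpose X = P"
proof -
  have "\<exists>X :: real^'n^'n. X ** transpose X = P \<and> (\<forall>i j. j \<notin> UNIV \<longrightarrow> X $ i $ j = 0)"
    by (rule symmetric_factorization) (use assms in \<open>auto simp: SPD_def\<close>)
  then obtain X :: "real^'n^'n" where X: "X ** transpose X = P"
    by blast
  \<comment> \<open>Invertibility of \<open>P\<close> yields a right inverse of \<open>X\<close>,
    and a square matrix with a right inverse is invertible.\<close>
  have "X ** (transpose X ** matrix_inv P) = mat 1"
    using X matrix_inv_right[OF SPD_invertible[OF assms]] by (simp add: matrix_mul_assoc)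
  then have "invertible X"
    using invertible_right_inverse by blast
  then show thesis
    using X that by blast
qed

lemma SPD_mult_transpose:
  assumes "invertible (X :: real^'n^'n)"
  shows "X ** transpose X \<in> SPD"
proof -
  have "y \<bullet> ((X ** transpose X) *v y) > 0" if "y \<noteq> 0" for y
  proof -
    have "invertible (transpose X)"
      using assms by (rule transpose_invertible)
    then have "transpose X *v y \<noteq> 0"
      using that by (metis invertible_left_inverse matrix_left_invertible_ker)
    moreover have "y \<bullet> ((X ** transpose X) *v y) = (transpose X *v y) \<bullet> (transpose X *v y)"
      by (simp add: dot_lmul_matrix flip: matrix_vector_mul_assoc)
    ultimately show ?thesis
      by simp
  qed
  then show ?thesis
    by (simp add: SPD_def matrix_transpose_mul)
qed

section \<open>The forms \<open>x ** transpose y\<close> and \<open>transpose x ** y\<close>\<close>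

lemma trace_square_skew_neg:
  assumes "transpose A = - A" "A \<noteq> (0 :: real^'n^'n)"
  shows "trace (A ** A) < 0"
proof -
  have "trace (A ** A) = - trace (A ** transpose A)"
    by (simp add: assms(1) matrix_mult_bilinear_simps trace_linear_simps)
  then show ?thesis
    using trace_mult_transpose_pos[OF assms(2)] by simp
qed

lemma transpose_minus: "transpose (- A) = - transpose (A :: 'a::ab_group_add^'n^'m)"
  by (simp add: transpose_def vec_eq_iff)

lemma bounded_bilinear_mult_transpose:
  "bounded_bilinear (\<lambda>x y :: real^'n^'n. x ** transpose y)"
  by (rule bounded_bilinear.comp[OF bounded_bilinear_matrix_mult bounded_linear_ident bounded_linear_transpose])

lemma bounded_bilinear_transpose_mult:
  "bounded_bilinear (\<lambda>x y :: real^'n^'n. transpose x ** y)"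
  by (rule bounded_bilinear.comp[OF bounded_bilinear_matrix_mult bounded_linear_transpose bounded_linear_ident])

lemma leaf_form_left: "leaf_form (\<lambda>x y :: real^'n^'n. x ** transpose y)"
proof (rule leaf_form.intro)
  fix x y p v w P :: "real^'n^'n"
  show "bounded_bilinear (\<lambda>x y :: real^'n^'n. x ** transpose y)"
    by (rule bounded_bilinear_mult_transpose)
  show "transpose (x ** transpose y) = y ** transpose x"
    by (simp add: matrix_transpose_mul)
  show "v = 0" if "invertible x" "v ** transpose x = 0"
    using matrix_inv_cancel(3)[OF transpose_invertible[OF that(1)], of v] that(2) by simp
  show "x ** transpose x \<in> SPD" if "invertible x"
    using that by (rule SPD_mult_transpose)
  show "\<exists>x :: real^'n^'n. invertible x \<and> x ** transpose x = P" if "P \<in> SPD"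
    using SPD_factorization[OF that] by metis
  {
    assume p: "invertible p" and v: "v ** transpose p + p ** transpose v = 0"
    {
      assume w: "w ** transpose p + p ** transpose w = 0"
      have "(v ** matrix_inv p ** w) ** transpose p = v ** matrix_inv p ** (w ** transpose p)"
        by (simp add: matrix_mul_assoc)
      \<comment> \<open>Tangency of \<open>w\<close> turns the last factor into one starting with
        \<open>p\<close>, which cancels \<open>matrix_inv p\<close>.\<close>
      also have "w ** transpose p = - (p ** transpose w)"
        using w by (simp add: eq_neg_iff_add_eq_0)
      finally have 1: "(v ** matrix_inv p ** w) ** transpose p = - (v ** transpose w)"
        by (simp add: matrix_mult_bilinear_simps matrix_mul_assoc matrix_inv_cancel[OF p])
      \<comment> \<open>The second summand is the transpose of the first.\<close>
      have "p ** transpose (v ** matrix_inv p ** w) = transpose ((v ** matrix_inv p ** w) ** transpose p)"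
        by (simp add: matrix_transpose_mul)
      also have "\<dots> = - (w ** transpose v)"
        unfolding 1 by (simp add: matrix_transpose_mul transpose_minus)
      finally show "(v ** matrix_inv p ** w) ** transpose p + p ** transpose (v ** matrix_inv p ** w)
          = - (v ** transpose w + w ** transpose v)"
        by (simp add: 1)
    }
    assume "v \<noteq> 0"
    \<comment> \<open>Tangency of \<open>v\<close> says that the congruence of
      \<open>A + transpose A\<close> by \<open>p\<close> vanishes, so \<open>A\<close> is skew and
      the metric on \<open>v\<close> is the trace of its square.\<close>
    define A where "A = matrix_inv p ** v"
    have v_eq: "v = p ** A"
      by (simp add: A_def matrix_inv_cancel[OF p])
    have "p ** (A + transpose A) ** transpose p = 0"
      using v by (simp add: v_eq matrix_transpose_mul matrix_mult_bilinear_simps matrix_mul_assoc)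
    then have "matrix_inv p ** (p ** (A + transpose A) ** transpose p) ** matrix_inv (transpose p) = 0"
      by simp
    then have "transpose A = - A"
      using matrix_inv_cancel[OF p] matrix_inv_cancel[OF transpose_invertible[OF p]]
      by (simp add: matrix_mul_assoc[symmetric] matrix_inv_right[OF transpose_invertible[OF p]] eq_neg_iff_add_eq_0 add.commute)
    then have "trace (A ** A) < 0"
      using \<open>v \<noteq> 0\<close> v_eq by (intro trace_square_skew_neg) auto
    then show "trace_metric p v v < 0"
      by (simp add: trace_metric_def A_def matrix_mul_assoc)
  }
qed

lemma leaf_form_right: "leaf_form (\<lambda>x y :: real^'n^'n. transpose x ** y)"
proof (rule leaf_form.intro)
  fix x y p v w P :: "real^'n^'n"
  show "bounded_bilinear (\<lambda>x y :: real^'n^'n. transpose x ** y)"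
    by (rule bounded_bilinear_transpose_mult)
  show "transpose (transpose x ** y) = transpose y ** x"
    by (simp add: matrix_transpose_mul)
  show "v = 0" if "invertible x" "transpose v ** x = 0"
  proof -
    have "transpose v = 0"
      using matrix_inv_cancel(3)[OF that(1), of "transpose v"] that(2) by simp
    then show ?thesis
      by (simp add: transpose_def vec_eq_iff)
  qed
  show "transpose x ** x \<in> SPD" if "invertible x"
    using SPD_mult_transpose[OF transpose_invertible[OF that]] by simp
  show "\<exists>x :: real^'n^'n. invertible x \<and> transpose x ** x = P" if "P \<in> SPD"
    using SPD_factorization[OF that] transpose_invertible transpose_transpose by metis
  {
    assume p: "invertible p" and v: "transpose v ** p + transpose p ** v = 0"
    {
      assume w: "transpose w ** p + transpose p ** w = 0"
      have "transpose p ** (v ** matrix_inv p ** w) = (transpose p ** v) ** matrix_inv p ** w"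
        by (simp add: matrix_mul_assoc)
      \<comment> \<open>In the mirrored computation it is the tangency of \<open>v\<close> that
        brings \<open>p\<close> next to its inverse.\<close>
      also have "transpose p ** v = - (transpose v ** p)"
        using v by (simp add: eq_neg_iff_add_eq_0 add.commute)
      finally have 1: "transpose p ** (v ** matrix_inv p ** w) = - (transpose v ** w)"
        by (simp add: matrix_mult_bilinear_simps matrix_inv_cancel[OF p])
      have "transpose (v ** matrix_inv p ** w) ** p = transpose (transpose p ** (v ** matrix_inv p ** w))"
        by (simp add: matrix_transpose_mul)
      also have "\<dots> = - (transpose w ** v)"
        unfolding 1 by (simp add: matrix_transpose_mul transpose_minus)
      finally show "transpose (v ** matrix_inv p ** w) ** p + transpose p ** (v ** matrix_inv p ** w)
          = - (transpose v ** w + transpose w ** v)"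
        by (simp add: 1)
    }
    assume "v \<noteq> 0"
    \<comment> \<open>Here \<open>p\<close> is split off on the right, and cyclicity of the trace
      identifies the metric on \<open>v\<close> with the trace of \<open>A ** A\<close>.\<close>
    define A where "A = v ** matrix_inv p"
    have v_eq: "v = A ** p"
      by (simp add: A_def matrix_inv_cancel[OF p])
    have "transpose p ** ((A + transpose A) ** p) = 0"
      using v by (simp add: v_eq matrix_transpose_mul matrix_mult_bilinear_simps matrix_mul_assoc add.commute)
    then have "matrix_inv (transpose p) ** (transpose p ** ((A + transpose A) ** p)) ** matrix_inv p = 0"
      by simp
    then have "A + transpose A = 0"
      by (simp only: matrix_inv_cancel[OF p] matrix_inv_cancel[OF transpose_invertible[OF p]])
    then have "transpose A = - A"
      by (simp add: eq_neg_iff_add_eq_0 add.commute)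
    then have "trace (A ** A) < 0"
      using \<open>v \<noteq> 0\<close> v_eq by (intro trace_square_skew_neg) auto
    moreover have "trace_metric p v v = trace (A ** A)"
      unfolding trace_metric_def A_def by (metis matrix_mul_assoc trace_mul_sym)
    ultimately show "trace_metric p v v < 0"
      by simp
  }
qed

section \<open>Isometries with the orthogonal group\<close>

lemma matrix_inv_mult:
  fixes A B :: "real^'n^'n"
  assumes A: "invertible A" and B: "invertible B"
  shows "matrix_inv (A ** B) = matrix_inv B ** matrix_inv A"
proof -
  have "matrix_inv B ** matrix_inv A = matrix_inv B ** matrix_inv A ** ((A ** B) ** matrix_inv (A ** B))"
    by (simp add: matrix_inv_right[OF invertible_mult[OF A B]])
  also have "\<dots> = matrix_inv (A ** B)"
    by (simp add: matrix_mul_assoc[symmetric] matrix_inv_cancel[OF A] matrix_inv_cancel[OF B])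
  finally show ?thesis
    by simp
qed

lemma invertible_matrix_inv:
  fixes A :: "real^'n^'n"
  assumes "invertible A"
  shows "invertible (matrix_inv A)"
  using matrix_inv_left[OF assms] invertible_right_inverse by blast

text \<open>The factor \<open>q\<close> cancels inside each product
  \<open>matrix_inv p ** v\<close>, before any trace is taken.\<close>

lemma trace_metric_mult_left:
  fixes p q v w :: "real^'n^'n"
  assumes p: "invertible p" and q: "invertible q"
  shows "trace_metric (q ** p) (q ** v) (q ** w) = trace_metric p v w"
  by (simp add: trace_metric_def matrix_inv_mult[OF q p] matrix_mul_assoc matrix_inv_cancel[OF q])

text \<open>Right translation conjugates the matrix under the trace by \<open>q\<close>, which
  cyclicity of the trace undoes.\<close>

lemma trace_metric_mult_right:
  fixes p q v w :: "real^'n^'n"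
  assumes p: "invertible p" and q: "invertible q"
  shows "trace_metric (p ** q) (v ** q) (w ** q) = trace_metric p v w"
proof -
  have "trace_metric (p ** q) (v ** q) (w ** q)
      = trace (matrix_inv q ** (matrix_inv p ** v ** matrix_inv p ** w ** q))"
    by (simp add: trace_metric_def matrix_inv_mult[OF p q] matrix_mul_assoc matrix_inv_cancel[OF q])
  also have "\<dots> = trace ((matrix_inv p ** v ** matrix_inv p ** w ** q) ** matrix_inv q)"
    by (rule trace_mul_sym)
  also have "\<dots> = trace_metric p v w"
    by (simp add: trace_metric_def matrix_inv_cancel[OF q])
  finally show ?thesis .
qed

lemma mat_1_SPD: "(mat 1 :: real^'n^'n) \<in> SPD"
  using SPD_mult_transpose[of "mat 1 :: real^'n^'n"] by (simp add: invertible_def exI[of _ "mat 1"])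

text \<open>Being a leaf of both families, the orthogonal group gets its semi-Riemannian structure
  from the general results on leaves. A one-sided inverse of a square matrix is two-sided, so either
  condition in \<open>orthogonal_matrix\<close> implies the other.\<close>

lemma orthogonal_group_eq_leafL: "(orthogonal_group :: (real^'n^'n) set) = leafL (mat 1)"
  and orthogonal_group_eq_leafR: "(orthogonal_group :: (real^'n^'n) set) = leafR (mat 1)"
  unfolding orthogonal_group_def leafL_def leafR_def GL_def orthogonal_matrix_def invertible_def
  by (auto simp: matrix_left_right_inverse)

text \<open>Any point \<open>q\<close> of the leaf works: as \<open>P = q ** transpose q\<close>,
  left translation by \<open>matrix_inv q\<close> turns \<open>X ** transpose X = P\<close> into the
  orthogonality relation, and it preserves the metric at every invertible point.\<close>

lemma leafL_isometric_orthogonal_group: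
  fixes P :: "real^'n^'n"
  assumes P: "P \<in> SPD"
  shows "isometric_submanifolds GL trace_metric (leafL P) orthogonal_group"
proof -
  obtain q :: "real^'n^'n" where q: "invertible q" "q ** transpose q = P"
    using SPD_factorization[OF P] .
  let ?f = "\<lambda>X. matrix_inv q ** X" and ?h = "\<lambda>X. q ** X"
  have inv: "transpose q ** transpose (matrix_inv q) = mat 1"
    by (simp add: matrix_inv_left[OF q(1)] flip: matrix_transpose_mul)
  show ?thesis
    unfolding orthogonal_group_eq_leafL
  proof (rule isometric_submanifolds_linearI[where f = ?f and h = ?h])
    show "semi_riemannian_submanifold GL trace_metric (leafL P)"
      unfolding leafL_def by (rule leaf_form.semi_riemannian_leaf[OF leaf_form_left P])
    show "semi_riemannian_submanifold GL trace_metric (leafL (mat 1 :: real^'n^'n))"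
      unfolding leafL_def by (rule leaf_form.semi_riemannian_leaf[OF leaf_form_left mat_1_SPD])
    show "bounded_linear ?f" "bounded_linear ?h"
      by (rule bounded_bilinear.bounded_linear_right[OF bounded_bilinear_matrix_mult])+
    show "?f ` leafL P \<subseteq> leafL (mat 1)"
    proof (clarsimp simp: leafL_def GL_def)
      fix X :: "real^'n^'n"
      assume X: "invertible X" "P = X ** transpose X"
      have "?f X ** transpose (?f X) = matrix_inv q ** (q ** transpose q) ** transpose (matrix_inv q)"
        by (simp add: matrix_transpose_mul q(2) X(2) matrix_mul_assoc)
      also have "\<dots> = mat 1"
        by (simp add: inv matrix_mul_assoc[symmetric] matrix_inv_cancel[OF q(1)])
      finally show "invertible (?f X) \<and> ?f X ** transpose (?f X) = mat 1"
        using invertible_mult[OF invertible_matrix_inv[OF q(1)] X(1)] by blast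
    qed
    show "?h ` leafL (mat 1) \<subseteq> leafL P"
    proof (clarsimp simp: leafL_def GL_def)
      fix Y :: "real^'n^'n"
      assume Y: "invertible Y" "Y ** transpose Y = mat 1"
      have "?h Y ** transpose (?h Y) = q ** (Y ** transpose Y) ** transpose q"
        by (simp add: matrix_transpose_mul matrix_mul_assoc)
      then show "invertible (?h Y) \<and> ?h Y ** transpose (?h Y) = P"
        using invertible_mult[OF q(1) Y(1)] Y(2) q(2) by simp
    qed
    show "?h (?f x) = x" "?f (?h x) = x" for x :: "real^'n^'n"
      by (simp_all add: matrix_inv_cancel[OF q(1)])
    show "trace_metric (?f p) (?f v) (?f w) = trace_metric p v w" if "p \<in> leafL P" for p v w
      using that by (intro trace_metric_mult_left invertible_matrix_inv q(1)) (simp add: leafL_def GL_def)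
  qed
qed

text \<open>The mirror image, with right translations and a point \<open>q\<close> satisfying
  \<open>transpose q ** q = P\<close>.\<close>

lemma leafR_isometric_orthogonal_group:
  fixes P :: "real^'n^'n"
  assumes P: "P \<in> SPD"
  shows "isometric_submanifolds GL trace_metric (leafR P) orthogonal_group"
proof -
  obtain q :: "real^'n^'n" where q: "invertible q" "transpose q ** q = P"
    using leaf_form.SPD_form[OF leaf_form_right P] by blast
  let ?f = "\<lambda>X. X ** matrix_inv q" and ?h = "\<lambda>X. X ** q"
  have inv: "transpose (matrix_inv q) ** transpose q = mat 1"
    by (simp add: matrix_inv_right[OF q(1)] flip: matrix_transpose_mul)
  show ?thesis
    unfolding orthogonal_group_eq_leafR
  proof (rule isometric_submanifolds_linearI[where f = ?f and h = ?h])
    show "semi_riemannian_submanifold GL trace_metric (leafR P)"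
      unfolding leafR_def by (rule leaf_form.semi_riemannian_leaf[OF leaf_form_right P])
    show "semi_riemannian_submanifold GL trace_metric (leafR (mat 1 :: real^'n^'n))"
      unfolding leafR_def by (rule leaf_form.semi_riemannian_leaf[OF leaf_form_right mat_1_SPD])
    show "bounded_linear ?f" "bounded_linear ?h"
      by (rule bounded_bilinear.bounded_linear_left[OF bounded_bilinear_matrix_mult])+
    show "?f ` leafR P \<subseteq> leafR (mat 1)"
    proof (clarsimp simp: leafR_def GL_def)
      fix X :: "real^'n^'n"
      assume X: "invertible X" "P = transpose X ** X"
      have "transpose (?f X) ** ?f X = transpose (matrix_inv q) ** (transpose q ** q) ** matrix_inv q"
        by (simp add: matrix_transpose_mul q(2) X(2) matrix_mul_assoc)
      also have "\<dots> = mat 1"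
        by (simp add: inv matrix_mul_assoc matrix_inv_right[OF q(1)])
      finally show "invertible (?f X) \<and> transpose (?f X) ** ?f X = mat 1"
        using invertible_mult[OF X(1) invertible_matrix_inv[OF q(1)]] by blast
    qed
    show "?h ` leafR (mat 1) \<subseteq> leafR P"
    proof (clarsimp simp: leafR_def GL_def)
      fix Y :: "real^'n^'n"
      assume Y: "invertible Y" "transpose Y ** Y = mat 1"
      have "transpose (?h Y) ** ?h Y = transpose q ** (transpose Y ** Y) ** q"
        by (simp add: matrix_transpose_mul matrix_mul_assoc)
      then show "invertible (?h Y) \<and> transpose (?h Y) ** ?h Y = P"
        using invertible_mult[OF Y(1) q(1)] Y(2) q(2) by simp
    qed
    show "?h (?f x) = x" "?f (?h x) = x" for x :: "real^'n^'n"
      by (simp_all add: matrix_inv_cancel[OF q(1)])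
    show "trace_metric (?f p) (?f v) (?f w) = trace_metric p v w" if "p \<in> leafR P" for p v w
      using that by (intro trace_metric_mult_right invertible_matrix_inv q(1)) (simp add: leafR_def GL_def)
  qed
qed

theorem proposition4p5:
  shows "(GL :: (real^'n^'n) set) = (\<Union>P\<in>SPD. leafL P) \<and>
    (GL :: (real^'n^'n) set) = (\<Union>P\<in>SPD. leafR P) \<and>
    foliation (GL :: (real^'n^'n) set) (leafL ` SPD) \<and>
    foliation (GL :: (real^'n^'n) set) (leafR ` SPD) \<and>
    (\<forall>L \<in> leafL ` SPD \<union> leafR ` (SPD :: (real^'n^'n) set).
       totally_geodesic GL trace_metric L \<and>
       anti_riemannian_submanifold GL trace_metric L \<and>
       isometric_submanifolds GL trace_metric L orthogonal_group)"
proof -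
  \<comment> \<open>Both leaf maps are unfolded as functions, also where they occur unapplied in an
    image over \<open>SPD\<close>, so that they match the abbreviation \<open>leaf\<close>.\<close>
  have left: "leafL = (\<lambda>P :: real^'n^'n. {X \<in> GL. X ** transpose X = P})"
    and right: "leafR = (\<lambda>P :: real^'n^'n. {X \<in> GL. transpose X ** X = P})"
    by (simp_all add: fun_eq_iff leafL_def leafR_def)
  have "totally_geodesic GL trace_metric (leafL P)" "totally_geodesic GL trace_metric (leafR P)"
    "anti_riemannian_submanifold GL trace_metric (leafL P)"
    "anti_riemannian_submanifold GL trace_metric (leafR P)"
    if "P \<in> SPD" for P :: "real^'n^'n"
    unfolding left right
    by (rule leaf_form.totally_geodesic_leaf[OF leaf_form_left that]
        leaf_form.totally_geodesic_leaf[OF leaf_form_right that]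
        leaf_form.anti_riemannian_leaf[OF leaf_form_left that]
        leaf_form.anti_riemannian_leaf[OF leaf_form_right that])+
  moreover have "GL = (\<Union>P\<in>SPD. leafL (P :: real^'n^'n))" "foliation GL (leafL ` (SPD :: (real^'n^'n) set))"
    unfolding left
    by (rule leaf_form.GL_eq_Union_leaf[OF leaf_form_left] leaf_form.foliation_leaves[OF leaf_form_left])+
  moreover have "GL = (\<Union>P\<in>SPD. leafR (P :: real^'n^'n))" "foliation GL (leafR ` (SPD :: (real^'n^'n) set))"
    unfolding right
    by (rule leaf_form.GL_eq_Union_leaf[OF leaf_form_right] leaf_form.foliation_leaves[OF leaf_form_right])+
  ultimately show ?thesis
    using leafL_isometric_orthogonal_group leafR_isometric_orthogonal_group
    by (intro conjI ballI) (auto elim!: UnE imageE)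
qed

end
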